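(* Let $F$ be a topological field that is disconnected (as a topological space) and complete with respect to its canonical (additive group) uniformity. Let $A$ be an $F$-algebra. Then $A$ is isomorphic, as an $F$-algebra, to $C(X,F)$ for some Stone space $X$ if and only if $A$ is a Gelfand algebra, $A$ is semisimple, $A$ is complete with respect to its canonical uniformity, and the $F$-linear span $\langle B(A)\rangle_F$ of the set of idempotents $B(A)=\{e\in A: e^2=e\}$ is dense in $A$ for the topology of the canonical uniformity.
   Context: Topological fields have continuous addition, multiplication and inversion (on $F^\times$) and are assumed proper, i.e. their topology is not indiscrete (hence it is Hausdorff). The canonical uniformity of $F$ is the uniformity of its additive topological group. $F$-algebras are commutative and unital. $C(X,F)$ is the $F$-algebra of continuous functions $X\to F$ with pointwise operations. A Stone space is a compact Hausdorff zero-dimensional space. $\mathrm{Max}(A)$ is the set of maximal ideals of $A$. $A$ is Gelfand if for every $M\in\mathrm{Max}(A)$ the canonical map $F\to A/M$ is an isomorphism (written $A/M=F$; so $a+M$ is regarded as an element of $F$). $A$ is semisimple if $\bigcap_{M\in\mathrm{Max}(A)}M=\{0\}$. The spectrum of $a\in A$ is $\sigma(a)=\{\lambda\in F: a-\lambda\cdot 1 \text{ is not invertible}\}$. The canonical uniformity on a Gelfand algebra $A$ has as basic entourages the sets $V_U=\{(a,b)\in A\times A:(b-a)+M\in U\ \forall M\in\mathrm{Max}(A)\}=\{(a,b):\sigma(b-a)\subset U\}$, where $U$ ranges over a base of symmetric ($U=-U$) open neighborhoods of $0$ in $F$ (the uniformity does not depend on the base chosen). *)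

theory Defs
  imports "HOL-Analysis.Analysis"
begin

class topological_field = field + topological_ab_group_add + topological_semigroup_mult +
  assumes tendsto_inverse_nhds: "a \<noteq> 0 \<Longrightarrow> filterlim inverse (nhds (inverse a)) (nhds a)"
    and not_indiscrete: "\<exists>U. open U \<and> U \<noteq> {} \<and> U \<noteq> UNIV"

text \<open>
  A uniformity is represented by the filter of its entourages, as in the library class
  \<^class>\<open>uniform_space\<close>. That class is not used because the uniformity of an algebra
  depends on its scalar multiplication and hence cannot be a class parameter.
\<close>

definition uniformity_topology :: "('b \<times> 'b) filter \<Rightarrow> 'b topology" where
  "uniformity_topology E =
     topology (\<lambda>U. \<forall>x\<in>U. eventually (\<lambda>(x', y). x' = x \<longrightarrow> y \<in> U) E)"

lemma openin_uniformity_topology: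
  "openin (uniformity_topology E) U \<longleftrightarrow>
     (\<forall>x\<in>U. eventually (\<lambda>(x', y). x' = x \<longrightarrow> y \<in> U) E)"
proof -
  have "istopology (\<lambda>U. \<forall>x\<in>U. eventually (\<lambda>(x', y). x' = x \<longrightarrow> y \<in> U) E)"
    unfolding istopology_def
  proof (intro conjI allI impI ballI)
    fix S T x
    assume "\<forall>x\<in>S. eventually (\<lambda>(x', y). x' = x \<longrightarrow> y \<in> S) E"
      and "\<forall>x\<in>T. eventually (\<lambda>(x', y). x' = x \<longrightarrow> y \<in> T) E"
      and "x \<in> S \<inter> T"
    then have "eventually (\<lambda>(x', y). x' = x \<longrightarrow> y \<in> S) E"
      and "eventually (\<lambda>(x', y). x' = x \<longrightarrow> y \<in> T) E" by auto
    then show "eventually (\<lambda>(x', y). x' = x \<longrightarrow> y \<in> S \<inter> T) E"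
      by eventually_elim auto
  next
    fix K x
    assume K: "\<forall>S\<in>K. \<forall>x\<in>S. eventually (\<lambda>(x', y). x' = x \<longrightarrow> y \<in> S) E" and "x \<in> \<Union>K"
    then obtain S where S: "S \<in> K" "x \<in> S" by blast
    with K have "eventually (\<lambda>(x', y). x' = x \<longrightarrow> y \<in> S) E" by blast
    then show "eventually (\<lambda>(x', y). x' = x \<longrightarrow> y \<in> \<Union>K) E"
      by eventually_elim (use S in auto)
  qed
  then show ?thesis by (simp add: uniformity_topology_def)
qed

definition uniformity_complete :: "('b \<times> 'b) filter \<Rightarrow> bool" where
  "uniformity_complete E \<longleftrightarrow>
     (\<forall>\<Phi>. \<Phi> \<noteq> bot \<and> \<Phi> \<times>\<^sub>F \<Phi> \<le> E \<longrightarrow>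
        (\<exists>x. limitin (uniformity_topology E) (\<lambda>y. y) x \<Phi>))"

definition additive_uniformity :: "('b::topological_ab_group_add \<times> 'b) filter" where
  "additive_uniformity = filtercomap (\<lambda>(x, y). y - x) (nhds 0)"

text \<open>
  The sort \<open>{comm_ring, comm_monoid_mult}\<close> is that of commutative unital rings without
  \<open>0 \<noteq> 1\<close>: the zero algebra must be included, being \<open>C(X, F)\<close> for empty \<open>X\<close>.
\<close>

locale unital_algebra = vector_space smul
  for smul :: "'f::field \<Rightarrow> 'a::{comm_ring, comm_monoid_mult} \<Rightarrow> 'a" +
  assumes smul_mult_left: "smul c (a * b) = smul c a * b"

definition is_ideal :: "'a::{comm_ring, comm_monoid_mult} set \<Rightarrow> bool" where
  "is_ideal I \<longleftrightarrow> 0 \<in> I \<and> (\<forall>x\<in>I. \<forall>y\<in>I. x + y \<in> I) \<and> (\<forall>a. \<forall>x\<in>I. a * x \<in> I)"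

definition Max_ideals :: "'a::{comm_ring, comm_monoid_mult} set set" where
  "Max_ideals =
     {M. is_ideal M \<and> M \<noteq> UNIV \<and> (\<forall>I. is_ideal I \<and> M \<subseteq> I \<longrightarrow> I = M \<or> I = UNIV)}"

definition coset_of :: "'a::{comm_ring, comm_monoid_mult} set \<Rightarrow> 'a \<Rightarrow> 'a set" where
  "coset_of M a = {a + m | m. m \<in> M}"

text \<open>The quotient \<open>A/M\<close> is \<^term>\<open>range (coset_of M)\<close>.\<close>

definition canonical_map ::
    "('f::field \<Rightarrow> 'a::{comm_ring, comm_monoid_mult} \<Rightarrow> 'a) \<Rightarrow> 'a set \<Rightarrow> 'f \<Rightarrow> 'a set" where
  "canonical_map smul M c = coset_of M (smul c 1)"

text \<open>
  For an ideal \<open>M\<close> the canonical map is always a homomorphism of algebras from \<open>F\<close>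
  to \<open>A/M\<close>, so it is an isomorphism iff it is bijective.
\<close>

definition Gelfand :: "('f::field \<Rightarrow> 'a::{comm_ring, comm_monoid_mult} \<Rightarrow> 'a) \<Rightarrow> bool" where
  "Gelfand smul \<longleftrightarrow>
     (\<forall>M\<in>Max_ideals. bij_betw (canonical_map smul M) UNIV (range (coset_of M)))"

text \<open>The element \<open>a + M\<close> of \<open>A/M\<close>, regarded as an element of \<open>F\<close>.\<close>

definition residue_value ::
    "('f::field \<Rightarrow> 'a::{comm_ring, comm_monoid_mult} \<Rightarrow> 'a) \<Rightarrow> 'a set \<Rightarrow> 'a \<Rightarrow> 'f" where
  "residue_value smul M a = inv (canonical_map smul M) (coset_of M a)"

definition semisimple :: "'a::{comm_ring, comm_monoid_mult} itself \<Rightarrow> bool" where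
  "semisimple _ \<longleftrightarrow> \<Inter>(Max_ideals :: 'a set set) = {0}"

definition algebra_uniformity ::
    "('f::topological_field \<Rightarrow> 'a::{comm_ring, comm_monoid_mult} \<Rightarrow> 'a) \<Rightarrow> ('a \<times> 'a) filter" where
  "algebra_uniformity smul =
     (INF U \<in> {U. open U \<and> 0 \<in> U \<and> uminus ` U = U}.
        principal {(a, b). \<forall>M\<in>Max_ideals. residue_value smul M (b - a) \<in> U})"

definition idempotents :: "'a::{comm_ring, comm_monoid_mult} set" where
  "idempotents = {e. e * e = e}"

definition Stone_space :: "'x topology \<Rightarrow> bool" where
  "Stone_space X \<longleftrightarrow> compact_space X \<and> Hausdorff_space X \<and>
     neighbourhood_base_of (\<lambda>U. openin X U \<and> closedin X U) X"

text \<open>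
  Functions on the carrier of \<open>X\<close> are normalised to be \<^const>\<open>undefined\<close> outside it.
\<close>

definition continuous_functions :: "'x topology \<Rightarrow> ('x \<Rightarrow> 'f::topological_space) set" where
  "continuous_functions X = {f. continuous_map X euclidean f \<and> f \<in> extensional (topspace X)}"

definition isomorphic_to_continuous_functions ::
    "('f::topological_field \<Rightarrow> 'a::{comm_ring, comm_monoid_mult} \<Rightarrow> 'a) \<Rightarrow> 'x topology \<Rightarrow> bool" where
  "isomorphic_to_continuous_functions smul X \<longleftrightarrow>
     (\<exists>\<phi> :: 'a \<Rightarrow> 'x \<Rightarrow> 'f.
        bij_betw \<phi> UNIV (continuous_functions X) \<and>
        (\<forall>a b. \<phi> (a + b) = (\<lambda>x\<in>topspace X. \<phi> a x + \<phi> b x)) \<and>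
        (\<forall>a b. \<phi> (a * b) = (\<lambda>x\<in>topspace X. \<phi> a x * \<phi> b x)) \<and>
        \<phi> 1 = (\<lambda>x\<in>topspace X. 1) \<and>
        (\<forall>c a. \<phi> (smul c a) = (\<lambda>x\<in>topspace X. c * \<phi> a x)))"

end

theory Submission
  imports Defs
begin

text \<open>
  Suppose first that the algebra \<open>A\<close> is \<open>C(X, F)\<close> for a Stone space \<open>X\<close>. Its maximal ideals are
  the ideals of functions vanishing at a point: an ideal without a common zero contains, by
  compactness and division on clopen sets, the constant function \<open>1\<close>
  (\<open>ideal_without_common_zero\<close>). Thus the residue of a function at a maximal ideal is its value at
  the point, which shows that \<open>A\<close> is Gelfand and semisimple, and the canonical uniformity is that
  of uniform convergence. Uniform limits of continuous functions are continuous and \<open>F\<close> is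
  complete, so \<open>A\<close> is complete. A continuous function is uniformly close to a locally constant
  one, that is, to a linear combination of indicators of clopen sets (\<open>clopen_approximation\<close>), and
  these indicators are idempotents.
  
  Conversely, the points of \<open>X\<close> are the maximal ideals of \<open>A\<close>, and the supports
  \<open>{M. e \<notin> M}\<close> of idempotents \<open>e\<close> are a base of clopen sets. This base is closed under
  complements, finite intersections and finite unions since idempotents form a Boolean algebra.
  Compactness holds because every proper ideal lies in a maximal one (\<open>compact_spectrum\<close>).
  Density of the span of the idempotents has two consequences: a maximal ideal is determined by
  the idempotents in it, so the space is Hausdorff (\<open>idempotents_separate\<close>), and the residues of
  each element of \<open>A\<close> are a uniform limit of locally constant functions, so they form a continuous
  function on \<open>X\<close> (\<open>continuous_residue\<close>). This homomorphism from \<open>A\<close> to \<open>C(X, F)\<close> is injective by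
  semisimplicity. Its image contains the locally constant functions, because every clopen set is
  the support of an idempotent (\<open>clopen_is_basic\<close>); as these are dense and \<open>A\<close> is complete, it is
  all of \<open>C(X, F)\<close> (\<open>residue_surj\<close>).
\<close>

section \<open>Topological fields and uniform limits\<close>

lemma open_translate_vimage:
  fixes a :: "'f::topological_ab_group_add"
  assumes "open U"
  shows "open {x. x + a \<in> U}"
proof -
  have "open ((\<lambda>x. x + a) -` U)"
    by (intro open_vimage assms continuous_intros)
  then show ?thesis by (simp add: vimage_def)
qed

lemma symmetric_nhd_add_subset:
  fixes U :: "'f::topological_ab_group_add set"
  assumes "open U" "0 \<in> U"
  obtains W where "open W" "0 \<in> W" "\<And>x. x \<in> W \<Longrightarrow> - x \<in> W"
    "\<And>x y. x \<in> W \<Longrightarrow> y \<in> W \<Longrightarrow> x + y \<in> U"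
proof -
  have "((\<lambda>p. fst p + snd p) \<longlongrightarrow> 0 + 0) (nhds (0::'f) \<times>\<^sub>F nhds 0)"
    by (intro tendsto_add filterlim_fst filterlim_snd)
  then have "eventually (\<lambda>p. fst p + snd p \<in> U) (nhds (0::'f) \<times>\<^sub>F nhds 0)"
    using assms by (simp add: tendsto_def)
  then obtain P where P: "eventually P (nhds (0::'f))" "\<And>x y. P x \<Longrightarrow> P y \<Longrightarrow> x + y \<in> U"
    by (auto simp: eventually_prod_same)
  then obtain S where S: "open S" "0 \<in> S" "\<And>x. x \<in> S \<Longrightarrow> P x"
    by (auto simp: eventually_nhds)
  have "open (S \<inter> uminus -` S)"
    by (intro open_Int open_vimage S continuous_intros)
  then show thesis
    by (rule that) (use S P in auto)
qed

text \<open>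
  A topology on a field that is not indiscrete separates points: a nonempty proper open set contains some
  \<open>p\<close> and misses some \<open>q\<close>, and its preimage under the affine map with \<open>0 \<mapsto> p\<close> and \<open>x - y \<mapsto> q\<close>
  is a neighbourhood of \<open>0\<close> that misses \<open>x - y\<close>.
\<close>

lemma eq_if_diff_in_all_nhds:
  fixes x y :: "'f::topological_field"
  assumes "\<And>U. open U \<Longrightarrow> 0 \<in> U \<Longrightarrow> x - y \<in> U"
  shows "x = y"
proof (rule ccontr)
  assume "x \<noteq> y"
  obtain U :: "'f set" and p q where U: "open U" "p \<in> U" "q \<notin> U"
    using not_indiscrete by blast
  define c where "c = (q - p) / (x - y)"
  have "open ((\<lambda>z. p + c * z) -` U)"
    by (intro open_vimage U continuous_intros)
  from assms[OF this] U have "p + c * (x - y) \<in> U" by simp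
  moreover have "p + c * (x - y) = q"
    using \<open>x \<noteq> y\<close> by (simp add: c_def)
  ultimately show False using U by simp
qed

lemma open_nonzero: "open (- {0::'f::topological_field})"
proof (subst open_subopen, intro ballI)
  fix x :: 'f assume "x \<in> - {0}"
  then obtain U where U: "open U" "0 \<in> U" "0 - x \<notin> U"
    using eq_if_diff_in_all_nhds[of 0 x] by auto
  then have "open {y. y + (- x) \<in> U}" "x \<in> {y. y + (- x) \<in> U}" "{y. y + (- x) \<in> U} \<subseteq> - {0}"
    using open_translate_vimage[OF U(1), of "- x"] by auto
  then show "\<exists>T. open T \<and> x \<in> T \<and> T \<subseteq> - {0}" by blast
qed

text \<open>
  Only the filter of values \<open>f\<close> takes along \<open>\<Phi>\<close> has to be Cauchy; this is how a Cauchy filter of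
  functions is evaluated at a single point. The conclusion avoids the topology generated by the
  uniformity: the translates \<open>{y. y - l \<in> U}\<close> are open in it, which is all that a limit is used for.
\<close>

lemma complete_field_cauchy_limit:
  fixes \<Phi> :: "'b filter" and f :: "'b \<Rightarrow> 'f::topological_field"
  assumes "uniformity_complete (additive_uniformity :: ('f \<times> 'f) filter)" "\<Phi> \<noteq> bot"
    and cauchy: "\<And>U. open U \<Longrightarrow> 0 \<in> U \<Longrightarrow>
      \<exists>P. eventually P \<Phi> \<and> (\<forall>a b. P a \<longrightarrow> P b \<longrightarrow> f b - f a \<in> U)"
  obtains l where "\<And>U. open U \<Longrightarrow> 0 \<in> U \<Longrightarrow> eventually (\<lambda>a. f a - l \<in> U) \<Phi>"
proof -
  let ?E = "additive_uniformity :: ('f \<times> 'f) filter"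
  have ev_E: "eventually Q ?E \<longleftrightarrow>
      (\<exists>U. open U \<and> 0 \<in> U \<and> (\<forall>x y. y - x \<in> U \<longrightarrow> Q (x, y)))" for Q
  proof
    assume "eventually Q ?E"
    then obtain R where R: "eventually R (nhds (0::'f))" "\<And>x y. R (y - x) \<Longrightarrow> Q (x, y)"
      by (auto simp: additive_uniformity_def eventually_filtercomap)
    then obtain U where "open U" "0 \<in> U" "\<And>w. w \<in> U \<Longrightarrow> R w"
      by (auto simp: eventually_nhds)
    with R show "\<exists>U. open U \<and> 0 \<in> U \<and> (\<forall>x y. y - x \<in> U \<longrightarrow> Q (x, y))" by blast
  next
    assume "\<exists>U. open U \<and> 0 \<in> U \<and> (\<forall>x y. y - x \<in> U \<longrightarrow> Q (x, y))"
    then obtain U where "open U" "0 \<in> U" "\<And>x y. y - x \<in> U \<Longrightarrow> Q (x, y)" by blast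
    then show "eventually Q ?E"
      unfolding additive_uniformity_def eventually_filtercomap
      by (intro exI[of _ "\<lambda>w. w \<in> U"]) (auto simp: eventually_nhds)
  qed
  have "filtermap f \<Phi> \<times>\<^sub>F filtermap f \<Phi> \<le> ?E"
  proof (rule filter_leI)
    fix Q assume "eventually Q ?E"
    then obtain U where U: "open U" "0 \<in> U" "\<And>x y. y - x \<in> U \<Longrightarrow> Q (x, y)"
      unfolding ev_E by blast
    then obtain P where P: "eventually P \<Phi>" "\<And>a b. P a \<Longrightarrow> P b \<Longrightarrow> f b - f a \<in> U"
      using cauchy by blast
    have "eventually (\<lambda>x. x \<in> f ` Collect P) (filtermap f \<Phi>)"
      using P(1) by (auto simp: eventually_filtermap elim: eventually_mono)
    then show "eventually Q (filtermap f \<Phi> \<times>\<^sub>F filtermap f \<Phi>)"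
      unfolding eventually_prod_same using P U by (intro exI[of _ "\<lambda>x. x \<in> f ` Collect P"]) auto
  qed
  moreover have "filtermap f \<Phi> \<noteq> bot"
    using assms(2) by (simp add: filtermap_bot_iff)
  ultimately obtain l where l: "limitin (uniformity_topology ?E) (\<lambda>y. y) l (filtermap f \<Phi>)"
    using assms(1) unfolding uniformity_complete_def by blast
  show thesis
  proof
    fix U :: "'f set" assume U: "open U" "0 \<in> U"
    have "openin (uniformity_topology ?E) {y. y - l \<in> U}"
      unfolding openin_uniformity_topology
    proof
      fix z assume z: "z \<in> {y. y - l \<in> U}"
      have "open {w. w + (z - l) \<in> U}" by (rule open_translate_vimage) fact
      then show "\<forall>\<^sub>F (x', y) in ?E. x' = z \<longrightarrow> y \<in> {y. y - l \<in> U}"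
        unfolding ev_E using z by (intro exI[of _ "{w. w + (z - l) \<in> U}"]) auto
    qed
    with l U show "eventually (\<lambda>a. f a - l \<in> U) \<Phi>"
      by (auto simp: limitin_def eventually_filtermap)
  qed
qed

lemma continuous_map_uniform_limit:
  fixes g :: "'x \<Rightarrow> 'f::topological_ab_group_add"
  assumes "\<And>U. open U \<Longrightarrow> 0 \<in> U \<Longrightarrow>
    \<exists>h. continuous_map X euclidean h \<and> (\<forall>x\<in>topspace X. h x - g x \<in> U)"
  shows "continuous_map X euclidean g"
  unfolding continuous_map_atin limitin_canonical_iff
proof (intro ballI topological_tendstoI)
  fix x V assume x: "x \<in> topspace X" and V: "open V" "g x \<in> V"
  have "0 \<in> {w. w + g x \<in> V}" using V(2) by simp
  from symmetric_nhd_add_subset[OF open_translate_vimage[OF V(1)] this]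
  obtain U where U: "open U" "0 \<in> U" "\<And>u v. u \<in> U \<Longrightarrow> v \<in> U \<Longrightarrow> u + v \<in> {w. w + g x \<in> V}"
    by metis
  obtain W where W: "open W" "0 \<in> W" "\<And>u. u \<in> W \<Longrightarrow> - u \<in> W"
      "\<And>u v. u \<in> W \<Longrightarrow> v \<in> W \<Longrightarrow> u + v \<in> U"
    using symmetric_nhd_add_subset[OF U(1,2)] by metis
  obtain h where h: "continuous_map X euclidean h" "\<And>y. y \<in> topspace X \<Longrightarrow> h y - g y \<in> W"
    using assms[OF W(1,2)] by blast
  have "((\<lambda>y. h y - h x) \<longlongrightarrow> h x - h x) (atin X x)"
    using h(1) x by (intro tendsto_diff tendsto_const) (auto simp: continuous_map_atin)
  then have "eventually (\<lambda>y. h y - h x \<in> U) (atin X x)"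
    using U by (simp add: tendsto_def)
  moreover have "eventually (\<lambda>y. y \<in> topspace X) (atin X x)"
    by (auto simp: eventually_atin)
  ultimately show "eventually (\<lambda>y. g y \<in> V) (atin X x)"
  proof eventually_elim
    case (elim y)
    have "- (h y - g y) + (h x - g x) \<in> U"
      using h(2) x elim W by blast
    with elim U have "(h y - h x) + (- (h y - g y) + (h x - g x)) + g x \<in> V" by blast
    then show ?case by (simp add: algebra_simps)
  qed
qed

text \<open>
  On a clopen set extension by zero preserves continuity, so a function without zeros there has
  a continuous partial inverse on the whole space. With \<open>f = 1\<close> this gives the indicator of a
  clopen set.
\<close>

lemma continuous_map_inverse_on_clopen:
  fixes f :: "'x \<Rightarrow> 'f::topological_field"
  assumes "continuous_map X euclidean f" "openin X K" "closedin X K" "\<And>x. x \<in> K \<Longrightarrow> f x \<noteq> 0"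
  shows "continuous_map X euclidean (\<lambda>x. if x \<in> K then inverse (f x) else 0)"
  unfolding continuous_map_atin limitin_canonical_iff
proof
  fix x assume x: "x \<in> topspace X"
  show "((\<lambda>x. if x \<in> K then inverse (f x) else 0) \<longlongrightarrow> (if x \<in> K then inverse (f x) else 0))
          (atin X x)"
  proof (cases "x \<in> K")
    case True
    have "(f \<longlongrightarrow> f x) (atin X x)"
      using assms(1) x by (simp add: continuous_map_atin)
    then have lim: "((\<lambda>y. inverse (f y)) \<longlongrightarrow> inverse (f x)) (atin X x)"
      by (rule filterlim_compose[OF tendsto_inverse_nhds[OF assms(4)[OF True]]])
    have "eventually (\<lambda>y. y \<in> K) (atin X x)"
      using assms(2) True x by (auto simp: eventually_atin)
    then have "eventually (\<lambda>y. (if y \<in> K then inverse (f y) else 0) = inverse (f y)) (atin X x)"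
      by eventually_elim simp
    from tendsto_cong[OF this] lim True show ?thesis by simp
  next
    case False
    have "openin X (topspace X - K)" using assms(3) by blast
    then have "eventually (\<lambda>y. y \<notin> K) (atin X x)"
      using False x by (auto simp: eventually_atin)
    then have "eventually (\<lambda>y. (if y \<in> K then inverse (f y) else 0) = 0) (atin X x)"
      by eventually_elim simp
    from tendsto_cong[OF this] False show ?thesis by simp
  qed
qed

section \<open>Compact spaces with enough clopen sets\<close>

text \<open>
  Compactness in the form of an induction over a finite clopen cover. It replaces partitions into
  finitely many disjoint clopen sets, since a step that adds \<open>K\<close> only has to treat \<open>K - S\<close>.
\<close>

lemma clopen_cover_induct:
  assumes "compact_space X" "Q {}"
    and step: "\<And>x. x \<in> topspace X \<Longrightarrow> \<exists>K. openin X K \<and> closedin X K \<and> x \<in> K \<and>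
      (\<forall>S. openin X S \<longrightarrow> closedin X S \<longrightarrow> Q S \<longrightarrow> Q (S \<union> K))"
  shows "Q (topspace X)"
proof -
  obtain K where K: "\<And>x. x \<in> topspace X \<Longrightarrow> openin X (K x) \<and> closedin X (K x) \<and> x \<in> K x \<and>
      (\<forall>S. openin X S \<longrightarrow> closedin X S \<longrightarrow> Q S \<longrightarrow> Q (S \<union> K x))"
    using step by metis
  have "\<exists>\<F>. finite \<F> \<and> \<F> \<subseteq> K ` topspace X \<and> topspace X \<subseteq> \<Union>\<F>"
    using assms(1)[unfolded compact_space_alt, rule_format, of "K ` topspace X"] K by blast
  then obtain B where B: "finite B" "B \<subseteq> topspace X" "topspace X \<subseteq> \<Union>(K ` B)"
    by (metis finite_subset_image)
  have "openin X (\<Union>(K ` B)) \<and> closedin X (\<Union>(K ` B)) \<and> Q (\<Union>(K ` B))"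
    using B(1,2)
  proof induction
    case empty then show ?case using assms(2) by simp
  next
    case (insert b B)
    then have "Q (\<Union>(K ` B) \<union> K b)" using K[of b] by blast
    then show ?case using insert K[of b] by (simp add: openin_Un closedin_Un Un_commute)
  qed
  moreover have "\<Union>(K ` B) = topspace X"
    using B K openin_subset by blast
  ultimately show ?thesis by simp
qed

lemma Stone_space_clopen_nhd:
  assumes "Stone_space X" "openin X W" "x \<in> W"
  obtains K where "openin X K" "closedin X K" "x \<in> K" "K \<subseteq> W"
  using assms unfolding Stone_space_def neighbourhood_base_of by (metis subsetD)

section \<open>Ideals and idempotents\<close>

lemma is_ideal_minus: "is_ideal I \<Longrightarrow> x \<in> I \<Longrightarrow> - x \<in> I"
  unfolding is_ideal_def by (metis mult_1 mult_minus_left)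

lemma is_ideal_UNIV_iff: "is_ideal I \<Longrightarrow> I = UNIV \<longleftrightarrow> 1 \<in> I"
  unfolding is_ideal_def by (metis UNIV_I UNIV_eq_I mult.right_neutral)

lemma coset_of_eq_iff:
  assumes "is_ideal M"
  shows "coset_of M a = coset_of M b \<longleftrightarrow> a - b \<in> M"
proof
  have "a + 0 \<in> coset_of M a"
    using assms unfolding coset_of_def is_ideal_def by blast
  moreover assume "coset_of M a = coset_of M b"
  ultimately have "a + 0 \<in> coset_of M b" by blast
  then obtain m where "m \<in> M" "a + 0 = b + m" unfolding coset_of_def by blast
  then show "a - b \<in> M" by (simp add: algebra_simps)
next
  have sub: "coset_of M x \<subseteq> coset_of M y" if "x - y \<in> M" for x y
  proof
    fix z assume "z \<in> coset_of M x"
    then obtain m where m: "m \<in> M" "z = x + m" by (auto simp: coset_of_def)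
    then have "(x - y) + m \<in> M" "z = y + ((x - y) + m)"
      using that assms by (auto simp: is_ideal_def)
    then show "z \<in> coset_of M y" unfolding coset_of_def by blast
  qed
  assume ab: "a - b \<in> M"
  have "b - a \<in> M" using is_ideal_minus[OF assms ab] by simp
  with ab show "coset_of M a = coset_of M b" using sub by blast
qed

lemma proper_ideal_in_maximal:
  fixes I :: "'a::{comm_ring, comm_monoid_mult} set"
  assumes "is_ideal I" "1 \<notin> I"
  obtains M where "M \<in> Max_ideals" "I \<subseteq> M"
proof -
  let ?A = "{J. is_ideal J \<and> I \<subseteq> J \<and> (1::'a) \<notin> J}"
  have "\<exists>M\<in>?A. \<forall>J\<in>?A. M \<subseteq> J \<longrightarrow> J = M"
  proof (rule subset_Zorn_nonempty)
    show "?A \<noteq> {}" using assms by blast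
    fix C assume C: "C \<noteq> {}" "subset.chain ?A C"
    then have mem: "\<And>J. J \<in> C \<Longrightarrow> J \<in> ?A" and lin: "\<And>J K. J \<in> C \<Longrightarrow> K \<in> C \<Longrightarrow> J \<subseteq> K \<or> K \<subseteq> J"
      unfolding subset_chain_def by auto
    have "is_ideal (\<Union>C)"
      unfolding is_ideal_def
    proof (intro conjI ballI allI)
      show "0 \<in> \<Union>C" using C(1) mem by (auto simp: is_ideal_def)
      fix x assume "x \<in> \<Union>C"
      then obtain J where J: "J \<in> C" "x \<in> J" by blast
      show "a * x \<in> \<Union>C" for a using J mem[of J] unfolding is_ideal_def by blast
      fix y assume "y \<in> \<Union>C"
      then obtain K where K: "K \<in> C" "y \<in> K" by blast
      obtain L where "L \<in> C" "x \<in> L" "y \<in> L" using lin[OF J(1) K(1)] J K by blast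
      then show "x + y \<in> \<Union>C" using mem[of L] unfolding is_ideal_def by blast
    qed
    then show "\<Union>C \<in> ?A" using C(1) mem by blast
  qed
  then obtain M where M: "M \<in> ?A" "\<forall>J\<in>?A. M \<subseteq> J \<longrightarrow> J = M" by (rule bexE)
  have "M \<in> Max_ideals"
    unfolding Max_ideals_def
  proof (intro CollectI conjI allI impI)
    show "is_ideal M" "M \<noteq> UNIV" using M(1) by auto
    fix J assume J: "is_ideal J \<and> M \<subseteq> J"
    show "J = M \<or> J = UNIV"
    proof (cases "1 \<in> J")
      case True then show ?thesis using J is_ideal_UNIV_iff by blast
    next
      case False
      have "I \<subseteq> J" using M(1) J by blast
      with False M(2) J show ?thesis by simp
    qed
  qed
  then show thesis using that M(1) by blast
qed

lemma idempotent_one: "1 \<in> idempotents"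
  by (simp add: idempotents_def)

lemma idempotent_complement: "e \<in> idempotents \<Longrightarrow> 1 - e \<in> idempotents"
  by (simp add: idempotents_def algebra_simps)

lemma idempotent_mult:
  assumes "e \<in> idempotents" "f \<in> idempotents"
  shows "e * f \<in> idempotents"
proof -
  have "e * f * (e * f) = (e * e) * (f * f)" by (simp only: ac_simps)
  then show ?thesis using assms by (simp add: idempotents_def)
qed

text \<open>
  In the Boolean algebra of idempotents \<open>e + f - e f\<close> is the join, by De Morgan the complement of
  \<open>(1 - e) (1 - f)\<close>.
\<close>

lemma idempotent_join: "e \<in> idempotents \<Longrightarrow> f \<in> idempotents \<Longrightarrow> e + f - e * f \<in> idempotents"
  using idempotent_complement[OF idempotent_mult[OF idempotent_complement idempotent_complement]]
  by (simp add: algebra_simps)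

section \<open>Residues and the canonical uniformity\<close>

locale algebra_over_topological_field = unital_algebra smul
  for smul :: "'f::topological_field \<Rightarrow> 'a::{comm_ring, comm_monoid_mult} \<Rightarrow> 'a"
begin

abbreviation residue :: "'a set \<Rightarrow> 'a \<Rightarrow> 'f" where
  "residue \<equiv> residue_value smul"

abbreviation uniformity :: "('a \<times> 'a) filter" where
  "uniformity \<equiv> algebra_uniformity smul"

lemma smul_eq_mult: "smul c a = smul c 1 * a"
  by (simp flip: smul_mult_left)

lemma smul_in_ideal: "is_ideal I \<Longrightarrow> x \<in> I \<Longrightarrow> smul c x \<in> I"
  unfolding is_ideal_def by (metis smul_eq_mult)

text \<open>
  Each neighbourhood of zero contains a symmetric one, so arbitrary open neighbourhoods of zero
  may index the basic entourages.
\<close>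

lemma eventually_uniformity:
  "eventually P uniformity \<longleftrightarrow>
    (\<exists>U. open U \<and> 0 \<in> U \<and> (\<forall>a b. (\<forall>M\<in>Max_ideals. residue M (b - a) \<in> U) \<longrightarrow> P (a, b)))"
proof -
  let ?B = "{U::'f set. open U \<and> 0 \<in> U \<and> uminus ` U = U}"
  let ?V = "\<lambda>U. {(a, b). \<forall>M\<in>Max_ideals. residue M (b - a) \<in> U}"
  have sym_Int: "U \<inter> V \<in> ?B" if "U \<in> ?B" "V \<in> ?B" for U V
    using that by (auto simp: image_Int)
  have "eventually P uniformity \<longleftrightarrow> (\<exists>U\<in>?B. eventually P (principal (?V U)))"
    unfolding algebra_uniformity_def
  proof (rule eventually_INF_base)
    show "?B \<noteq> {}" by (auto intro!: exI[of _ UNIV])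
    fix U V assume "U \<in> ?B" "V \<in> ?B"
    then show "\<exists>W\<in>?B. principal (?V W) \<le> inf (principal (?V U)) (principal (?V V))"
      by (intro bexI[of _ "U \<inter> V"] sym_Int) auto
  qed
  also have "\<dots> \<longleftrightarrow> (\<exists>U\<in>?B. \<forall>a b. (\<forall>M\<in>Max_ideals. residue M (b - a) \<in> U) \<longrightarrow> P (a, b))"
    by (simp add: eventually_principal)
  also have "\<dots> \<longleftrightarrow> (\<exists>U. open U \<and> 0 \<in> U \<and>
      (\<forall>a b. (\<forall>M\<in>Max_ideals. residue M (b - a) \<in> U) \<longrightarrow> P (a, b)))"
  proof safe
    fix U :: "'f set"
    assume U: "open U" "0 \<in> U"
      and P: "\<forall>a b. (\<forall>M\<in>Max_ideals. residue M (b - a) \<in> U) \<longrightarrow> P (a, b)"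
    obtain W where W: "open W" "0 \<in> W" "\<And>x. x \<in> W \<Longrightarrow> - x \<in> W"
        "\<And>x y. x \<in> W \<Longrightarrow> y \<in> W \<Longrightarrow> x + y \<in> U"
      by (rule symmetric_nhd_add_subset[OF U]) blast
    have "uminus ` W = W" using W(3) by force
    moreover have "W \<subseteq> U" using W(2,4) by force
    ultimately show "\<exists>U\<in>?B. \<forall>a b. (\<forall>M\<in>Max_ideals. residue M (b - a) \<in> U) \<longrightarrow> P (a, b)"
      using W(1,2) P by (intro bexI[of _ W]) blast+
  qed auto
  finally show ?thesis .
qed

end

locale gelfand_algebra = algebra_over_topological_field smul
  for smul :: "'f::topological_field \<Rightarrow> 'a::{comm_ring, comm_monoid_mult} \<Rightarrow> 'a" +
  assumes gelfand: "Gelfand smul"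
begin

lemma residue_eq_iff:
  assumes M: "M \<in> Max_ideals"
  shows "residue M a = c \<longleftrightarrow> a - smul c 1 \<in> M"
proof -
  have bij: "bij_betw (canonical_map smul M) UNIV (range (coset_of M))"
    using gelfand M by (simp add: Gelfand_def)
  have "canonical_map smul M (residue M a) = coset_of M a"
    unfolding residue_value_def using bij by (intro bij_betw_inv_into_right) auto
  then have "residue M a = c \<longleftrightarrow> coset_of M a = canonical_map smul M c"
    using bij by (metis UNIV_I bij_betw_inv_into_left residue_value_def)
  then show ?thesis
    using M by (simp add: canonical_map_def coset_of_eq_iff Max_ideals_def)
qed

lemma diff_residue_in: "M \<in> Max_ideals \<Longrightarrow> a - smul (residue M a) 1 \<in> M"
  using residue_eq_iff by blast

lemma residue_eq_0_iff: "M \<in> Max_ideals \<Longrightarrow> residue M a = 0 \<longleftrightarrow> a \<in> M"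
  by (simp add: residue_eq_iff)

lemma residue_smul:
  assumes M: "M \<in> Max_ideals"
  shows "residue M (smul c a) = c * residue M a"
proof -
  have "smul c (a - smul (residue M a) 1) \<in> M"
    using M diff_residue_in[OF M] by (intro smul_in_ideal) (auto simp: Max_ideals_def)
  then show ?thesis by (simp add: residue_eq_iff[OF M] scale_right_diff_distrib)
qed

lemma residue_add:
  assumes M: "M \<in> Max_ideals"
  shows "residue M (a + b) = residue M a + residue M b"
proof -
  have "(a - smul (residue M a) 1) + (b - smul (residue M b) 1) \<in> M"
    using M diff_residue_in[OF M] by (auto simp: Max_ideals_def is_ideal_def)
  then show ?thesis by (simp add: residue_eq_iff[OF M] scale_left_distrib algebra_simps)
qed

lemma residue_one: "M \<in> Max_ideals \<Longrightarrow> residue M 1 = 1"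
  by (simp add: residue_eq_iff Max_ideals_def is_ideal_def)

lemma residue_diff:
  assumes M: "M \<in> Max_ideals"
  shows "residue M (a - b) = residue M a - residue M b"
  using residue_add[OF M, of a "smul (- 1) b"] residue_smul[OF M, of "- 1" b] by simp

lemma residue_mult:
  assumes M: "M \<in> Max_ideals"
  shows "residue M (a * b) = residue M a * residue M b"
proof -
  have "is_ideal M" using M by (simp add: Max_ideals_def)
  then have "b * (a - smul (residue M a) 1) \<in> M"
    using diff_residue_in[OF M, of a] by (auto simp: is_ideal_def)
  also have "b * (a - smul (residue M a) 1) = a * b - smul (residue M a) b"
    by (simp add: right_diff_distrib mult.commute smul_eq_mult[of _ b])
  finally show ?thesis
    using residue_diff[OF M, of "a * b" "smul (residue M a) b"]
    by (simp add: residue_smul[OF M] residue_eq_0_iff[OF M, symmetric])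
qed

lemma residue_idempotent:
  assumes "M \<in> Max_ideals" "e \<in> idempotents"
  shows "residue M e = 0 \<or> residue M e = 1"
proof -
  have "residue M e * residue M e = residue M e"
    using residue_mult[OF assms(1), of e e] assms(2) by (simp add: idempotents_def)
  then show ?thesis by auto
qed

lemma topspace_uniformity_topology: "topspace (uniformity_topology uniformity) = UNIV"
proof -
  have "openin (uniformity_topology uniformity) UNIV"
    by (simp add: openin_uniformity_topology case_prod_unfold)
  then show ?thesis using openin_subset by blast
qed

text \<open>
  The topology of the uniformity is given by its open sets. This lemma and the next one compare
  them with the sections of the basic entourages, so that density and limits become statements
  on uniform approximation of residues. The next one rests on a triangle inequality, hence on the
  additivity of residues.
\<close>

lemma openin_contains_entourage_section:
  assumes "openin (uniformity_topology uniformity) T" "a \<in> T"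
  obtains U where "open U" "0 \<in> U" "\<And>b. (\<And>M. M \<in> Max_ideals \<Longrightarrow> residue M (b - a) \<in> U) \<Longrightarrow> b \<in> T"
  using assms unfolding openin_uniformity_topology eventually_uniformity by auto

lemma entourage_section_contains_openin:
  assumes "open U" "0 \<in> U"
  obtains T where "openin (uniformity_topology uniformity) T" "a \<in> T"
    "\<And>b M. b \<in> T \<Longrightarrow> M \<in> Max_ideals \<Longrightarrow> residue M (b - a) \<in> U"
proof
  \<comment> \<open>The open set is the interior: the points that have an entire section inside the given one.\<close>
  let ?sec = "\<lambda>W b. {c. \<forall>M\<in>Max_ideals. residue M (c - b) \<in> W}"
  let ?T = "{b. \<exists>W. open W \<and> 0 \<in> W \<and> ?sec W b \<subseteq> ?sec U a}"
  show "openin (uniformity_topology uniformity) ?T"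
    unfolding openin_uniformity_topology
  proof
    fix b assume "b \<in> ?T"
    then obtain W where W: "open W" "0 \<in> W" "?sec W b \<subseteq> ?sec U a" by blast
    obtain W' where W': "open W'" "0 \<in> W'" "\<And>x. x \<in> W' \<Longrightarrow> - x \<in> W'"
        "\<And>x y. x \<in> W' \<Longrightarrow> y \<in> W' \<Longrightarrow> x + y \<in> W"
      by (rule symmetric_nhd_add_subset[OF W(1,2)]) blast
    have "c \<in> ?T" if c: "c \<in> ?sec W' b" for c
    proof -
      have "?sec W' c \<subseteq> ?sec W b"
      proof safe
        fix d and M :: "'a set" assume M: "M \<in> Max_ideals" and "\<forall>M\<in>Max_ideals. residue M (d - c) \<in> W'"
        then have "residue M (d - c) + residue M (c - b) \<in> W"
          using c W'(4) by blast
        then show "residue M (d - b) \<in> W" by (simp flip: residue_add[OF M])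
      qed
      from this W(3) have "?sec W' c \<subseteq> ?sec U a" by (rule subset_trans)
      with W' show ?thesis by blast
    qed
    then show "\<forall>\<^sub>F (x', y) in uniformity. x' = b \<longrightarrow> y \<in> ?T"
      unfolding eventually_uniformity using W'(1,2) by (intro exI[of _ W']) auto
  qed
  show "a \<in> ?T" using assms by blast
  fix b and M :: "'a set" assume "b \<in> ?T" "M \<in> Max_ideals"
  then obtain W where W: "0 \<in> W" "?sec W b \<subseteq> ?sec U a" by blast
  have "b \<in> ?sec W b" using W(1) by (simp add: residue_diff)
  with W \<open>M \<in> Max_ideals\<close> show "residue M (b - a) \<in> U" by blast
qed

lemma dense_iff_uniform_approximation:
  "uniformity_topology uniformity closure_of S = UNIV \<longleftrightarrow>
    (\<forall>a U. open U \<longrightarrow> 0 \<in> U \<longrightarrow> (\<exists>s\<in>S. \<forall>M\<in>Max_ideals. residue M s - residue M a \<in> U))"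
proof (intro iffI allI impI)
  fix a :: 'a and U :: "'f set"
  assume dense: "uniformity_topology uniformity closure_of S = UNIV" and U: "open U" "0 \<in> U"
  obtain T where T: "openin (uniformity_topology uniformity) T" "a \<in> T"
      "\<And>b M. b \<in> T \<Longrightarrow> M \<in> Max_ideals \<Longrightarrow> residue M (b - a) \<in> U"
    by (rule entourage_section_contains_openin[OF U, of a]) blast
  have "a \<in> uniformity_topology uniformity closure_of S" using dense by simp
  then obtain s where "s \<in> S" "s \<in> T" using T(1,2) unfolding in_closure_of by blast
  then show "\<exists>s\<in>S. \<forall>M\<in>Max_ideals. residue M s - residue M a \<in> U"
    using T(3) by (metis residue_diff)
next
  assume approx: "\<forall>a U. open U \<longrightarrow> 0 \<in> U \<longrightarrow>
    (\<exists>s\<in>S. \<forall>M\<in>Max_ideals. residue M s - residue M a \<in> U)"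
  have "\<exists>s. s \<in> S \<and> s \<in> T" if T: "openin (uniformity_topology uniformity) T" "a \<in> T" for a T
  proof -
    obtain U where "open U" "0 \<in> U"
        "\<And>b. (\<And>M. M \<in> Max_ideals \<Longrightarrow> residue M (b - a) \<in> U) \<Longrightarrow> b \<in> T"
      by (rule openin_contains_entourage_section[OF T]) blast
    then show ?thesis using approx by (metis residue_diff)
  qed
  then show "uniformity_topology uniformity closure_of S = UNIV"
    by (auto simp: in_closure_of topspace_uniformity_topology)
qed

lemma limitin_iff_uniform_convergence:
  "limitin (uniformity_topology uniformity) (\<lambda>b. b) a \<Phi> \<longleftrightarrow>
    (\<forall>U. open U \<longrightarrow> 0 \<in> U \<longrightarrow>
      eventually (\<lambda>b. \<forall>M\<in>Max_ideals. residue M b - residue M a \<in> U) \<Phi>)"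
proof (intro iffI allI impI)
  fix U :: "'f set"
  assume lim: "limitin (uniformity_topology uniformity) (\<lambda>b. b) a \<Phi>" and U: "open U" "0 \<in> U"
  obtain T where T: "openin (uniformity_topology uniformity) T" "a \<in> T"
      "\<And>b M. b \<in> T \<Longrightarrow> M \<in> Max_ideals \<Longrightarrow> residue M (b - a) \<in> U"
    by (rule entourage_section_contains_openin[OF U, of a]) blast
  have "eventually (\<lambda>b. b \<in> T) \<Phi>" using lim T(1,2) by (auto simp: limitin_def)
  then show "eventually (\<lambda>b. \<forall>M\<in>Max_ideals. residue M b - residue M a \<in> U) \<Phi>"
    by eventually_elim (use T(3) in \<open>simp flip: residue_diff\<close>)
next
  assume ev: "\<forall>U. open U \<longrightarrow> 0 \<in> U \<longrightarrow>
      eventually (\<lambda>b. \<forall>M\<in>Max_ideals. residue M b - residue M a \<in> U) \<Phi>"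
  have "eventually (\<lambda>b. b \<in> T) \<Phi>" if T: "openin (uniformity_topology uniformity) T" "a \<in> T" for T
  proof -
    obtain U where U: "open U" "0 \<in> U"
        "\<And>b. (\<And>M. M \<in> Max_ideals \<Longrightarrow> residue M (b - a) \<in> U) \<Longrightarrow> b \<in> T"
      by (rule openin_contains_entourage_section[OF T]) blast
    from ev[rule_format, OF U(1,2)] show ?thesis
      by eventually_elim (use U(3) in \<open>simp add: residue_diff\<close>)
  qed
  then show "limitin (uniformity_topology uniformity) (\<lambda>b. b) a \<Phi>"
    by (simp add: limitin_def topspace_uniformity_topology)
qed

lemma cauchy_iff_uniformly_cauchy:
  "\<Phi> \<times>\<^sub>F \<Phi> \<le> uniformity \<longleftrightarrow>
    (\<forall>U. open U \<longrightarrow> 0 \<in> U \<longrightarrow> (\<exists>P. eventually P \<Phi> \<and>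
      (\<forall>a b. P a \<longrightarrow> P b \<longrightarrow> (\<forall>M\<in>Max_ideals. residue M b - residue M a \<in> U))))"
proof (intro iffI allI impI filter_leI)
  fix U :: "'f set"
  assume le: "\<Phi> \<times>\<^sub>F \<Phi> \<le> uniformity" and U: "open U" "0 \<in> U"
  have "eventually (\<lambda>(a, b). \<forall>M\<in>Max_ideals. residue M (b - a) \<in> U) uniformity"
    unfolding eventually_uniformity using U by (intro exI[of _ U]) auto
  with le have "eventually (\<lambda>(a, b). \<forall>M\<in>Max_ideals. residue M (b - a) \<in> U) (\<Phi> \<times>\<^sub>F \<Phi>)"
    by (rule filter_leD)
  then show "\<exists>P. eventually P \<Phi> \<and>
      (\<forall>a b. P a \<longrightarrow> P b \<longrightarrow> (\<forall>M\<in>Max_ideals. residue M b - residue M a \<in> U))"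
    unfolding eventually_prod_same by (simp add: residue_diff)
next
  fix Q assume cauchy: "\<forall>U. open U \<longrightarrow> 0 \<in> U \<longrightarrow> (\<exists>P. eventually P \<Phi> \<and>
      (\<forall>a b. P a \<longrightarrow> P b \<longrightarrow> (\<forall>M\<in>Max_ideals. residue M b - residue M a \<in> U)))"
    and "eventually Q uniformity"
  then obtain U where U: "open U" "0 \<in> U"
      "\<And>a b. (\<And>M. M \<in> Max_ideals \<Longrightarrow> residue M (b - a) \<in> U) \<Longrightarrow> Q (a, b)"
    unfolding eventually_uniformity by auto
  from cauchy[rule_format, OF U(1,2)] obtain P where P: "eventually P \<Phi>"
      "\<And>a b M. P a \<Longrightarrow> P b \<Longrightarrow> M \<in> Max_ideals \<Longrightarrow> residue M b - residue M a \<in> U" by blast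
  show "eventually Q (\<Phi> \<times>\<^sub>F \<Phi>)"
    unfolding eventually_prod_same
    by (rule exI[of _ P]) (use P U(3) in \<open>simp add: residue_diff\<close>)
qed

end

text \<open>
  A continuous function varies by less than \<open>U\<close> on small clopen sets; the constants on finitely
  many of them are glued with idempotents. The lemma serves both directions of the theorem, with
  \<open>ev\<close> the evaluation of functions and with \<open>ev\<close> the residue, provided that every clopen set is
  the support of an idempotent.
\<close>

lemma (in algebra_over_topological_field) clopen_approximation:
  fixes ev :: "'x \<Rightarrow> 'a \<Rightarrow> 'f" and g :: "'x \<Rightarrow> 'f"
  assumes X: "Stone_space X"
    and ev_add: "\<And>x a b. x \<in> topspace X \<Longrightarrow> ev x (a + b) = ev x a + ev x b"
    and ev_smul: "\<And>x c a. x \<in> topspace X \<Longrightarrow> ev x (smul c a) = c * ev x a"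
    and indicator: "\<And>S. openin X S \<Longrightarrow> closedin X S \<Longrightarrow>
      \<exists>e\<in>idempotents. \<forall>x\<in>topspace X. ev x e = (if x \<in> S then 1 else 0)"
    and g: "continuous_map X euclidean g"
    and U: "open U" "0 \<in> U"
  obtains a where "a \<in> span idempotents" "\<And>x. x \<in> topspace X \<Longrightarrow> ev x a - g x \<in> U"
proof -
  \<comment> \<open>The approximation vanishes outside the part already covered, so that the values on the
      rest of the next clopen set can be added freely.\<close>
  let ?Q = "\<lambda>S. \<exists>a\<in>span idempotents. \<forall>x\<in>topspace X.
    (x \<in> S \<longrightarrow> ev x a - g x \<in> U) \<and> (x \<notin> S \<longrightarrow> ev x a = 0)"
  have "?Q (topspace X)"
  proof (rule clopen_cover_induct[where Q = ?Q])
    show "compact_space X" using X by (simp add: Stone_space_def)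
    have "ev x 0 = 0" if "x \<in> topspace X" for x
      using ev_smul[OF that, of 0 0] by simp
    then show "?Q {}" by (intro bexI[of _ 0]) (auto simp: span_zero)
    fix x assume x: "x \<in> topspace X"
    have "open ((\<lambda>v. g x - v) -` U)"
      by (intro open_vimage U continuous_intros)
    then have "openin X {y \<in> topspace X. g y \<in> (\<lambda>v. g x - v) -` U}"
      using g by (intro openin_continuous_map_preimage) auto
    moreover have "x \<in> {y \<in> topspace X. g y \<in> (\<lambda>v. g x - v) -` U}" using x U by simp
    ultimately obtain K where K: "openin X K" "closedin X K" "x \<in> K"
        "K \<subseteq> {y \<in> topspace X. g y \<in> (\<lambda>v. g x - v) -` U}"
      by (rule Stone_space_clopen_nhd[OF X])
    have "?Q (S \<union> K)" if S: "openin X S" "closedin X S" and Q: "?Q S" for S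
    proof -
      from Q obtain a where a: "a \<in> span idempotents" "\<And>y. y \<in> topspace X \<Longrightarrow>
          (y \<in> S \<longrightarrow> ev y a - g y \<in> U) \<and> (y \<notin> S \<longrightarrow> ev y a = 0)" by blast
      have "openin X (K - S)" "closedin X (K - S)" using K S by auto
      from indicator[OF this] obtain e where e: "e \<in> idempotents"
          "\<And>y. y \<in> topspace X \<Longrightarrow> ev y e = (if y \<in> K - S then 1 else 0)" by blast
      have "a + smul (g x) e \<in> span idempotents"
        by (intro span_add span_scale span_base[OF e(1)] a(1))
      moreover have "(y \<in> S \<union> K \<longrightarrow> ev y (a + smul (g x) e) - g y \<in> U) \<and>
          (y \<notin> S \<union> K \<longrightarrow> ev y (a + smul (g x) e) = 0)" if "y \<in> topspace X" for y
        using a(2)[OF that] e(2)[OF that] K(4) by (auto simp: ev_add[OF that] ev_smul[OF that])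
      ultimately show ?thesis by blast
    qed
    with K show "\<exists>K. openin X K \<and> closedin X K \<and> x \<in> K \<and>
        (\<forall>S. openin X S \<longrightarrow> closedin X S \<longrightarrow> ?Q S \<longrightarrow> ?Q (S \<union> K))" by blast
  qed
  then show thesis using that by blast
qed

section \<open>Algebras of continuous functions on Stone spaces\<close>

locale continuous_function_algebra = algebra_over_topological_field smul
  for smul :: "'f::topological_field \<Rightarrow> 'a::{comm_ring, comm_monoid_mult} \<Rightarrow> 'a" +
  fixes X :: "'x topology" and \<phi> :: "'a \<Rightarrow> 'x \<Rightarrow> 'f"
  assumes stone: "Stone_space X"
    and bij: "bij_betw \<phi> UNIV (continuous_functions X)"
    and map_add: "\<And>a b. \<phi> (a + b) = (\<lambda>x\<in>topspace X. \<phi> a x + \<phi> b x)"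
    and map_mult: "\<And>a b. \<phi> (a * b) = (\<lambda>x\<in>topspace X. \<phi> a x * \<phi> b x)"
    and map_one: "\<phi> 1 = (\<lambda>x\<in>topspace X. 1)"
    and map_smul: "\<And>c a. \<phi> (smul c a) = (\<lambda>x\<in>topspace X. c * \<phi> a x)"
begin

lemma eval_add: "x \<in> topspace X \<Longrightarrow> \<phi> (a + b) x = \<phi> a x + \<phi> b x"
  and eval_mult: "x \<in> topspace X \<Longrightarrow> \<phi> (a * b) x = \<phi> a x * \<phi> b x"
  and eval_one: "x \<in> topspace X \<Longrightarrow> \<phi> 1 x = 1"
  and eval_smul: "x \<in> topspace X \<Longrightarrow> \<phi> (smul c a) x = c * \<phi> a x"
  by (simp_all add: map_add map_mult map_one map_smul)

lemma eval_diff: "x \<in> topspace X \<Longrightarrow> \<phi> (a - b) x = \<phi> a x - \<phi> b x"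
  using eval_add[of x "a - b" b] by simp

lemma eval_zero: "x \<in> topspace X \<Longrightarrow> \<phi> 0 x = 0"
  using eval_diff[of x 0 0] by simp

lemmas eval_simps = eval_add eval_mult eval_one eval_smul eval_diff eval_zero

lemma continuous_eval: "continuous_map X euclidean (\<phi> a)"
  using bij_betwE[OF bij] by (auto simp: continuous_functions_def)

lemma eval_eqI:
  assumes "\<And>x. x \<in> topspace X \<Longrightarrow> \<phi> a x = \<phi> b x"
  shows "a = b"
proof -
  have "\<phi> a \<in> extensional (topspace X)" "\<phi> b \<in> extensional (topspace X)"
    using bij_betwE[OF bij] by (auto simp: continuous_functions_def)
  then have "\<phi> a = \<phi> b" using assms by (rule extensionalityI)
  then show ?thesis using bij by (auto simp: bij_betw_def inj_on_def)
qed

lemma eval_surj: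
  assumes "continuous_map X euclidean g"
  obtains a where "\<And>x. x \<in> topspace X \<Longrightarrow> \<phi> a x = g x"
proof -
  have "continuous_map X euclidean (restrict g (topspace X))"
    using assms by (rule continuous_map_eq) simp
  then have "restrict g (topspace X) \<in> range \<phi>"
    using bij by (simp add: bij_betw_def continuous_functions_def)
  then show thesis using that by (metis imageE restrict_apply')
qed

lemma eval_indicator:
  assumes "openin X S" "closedin X S"
  shows "\<exists>e\<in>idempotents. \<forall>x\<in>topspace X. \<phi> e x = (if x \<in> S then 1 else 0)"
proof -
  have "continuous_map X euclidean (\<lambda>x. if x \<in> S then inverse 1 else 0 :: 'f)"
    using assms by (intro continuous_map_inverse_on_clopen) auto
  then obtain e where e: "\<And>x. x \<in> topspace X \<Longrightarrow> \<phi> e x = (if x \<in> S then inverse 1 else 0)"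
    by (rule eval_surj) blast
  have "e * e = e" by (rule eval_eqI) (simp add: eval_mult e)
  then show ?thesis using e by (auto simp: idempotents_def)
qed

definition vanishing_ideal :: "'x \<Rightarrow> 'a set" where
  "vanishing_ideal x = {a. \<phi> a x = 0}"

lemma vanishing_ideal_maximal:
  assumes x: "x \<in> topspace X"
  shows "vanishing_ideal x \<in> Max_ideals"
  unfolding Max_ideals_def
proof (intro CollectI conjI allI impI)
  show "is_ideal (vanishing_ideal x)"
    using x by (simp add: is_ideal_def vanishing_ideal_def eval_simps)
  have "1 \<notin> vanishing_ideal x" using x by (simp add: vanishing_ideal_def eval_one)
  then show "vanishing_ideal x \<noteq> UNIV" by blast
  fix I assume I: "is_ideal I \<and> vanishing_ideal x \<subseteq> I"
  show "I = vanishing_ideal x \<or> I = UNIV"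
  proof (rule disjCI)
    assume "I \<noteq> UNIV"
    have "a \<in> vanishing_ideal x" if a: "a \<in> I" for a
    proof (rule ccontr)
      assume "a \<notin> vanishing_ideal x"
      then have "1 - smul (inverse (\<phi> a x)) a \<in> vanishing_ideal x"
        using x by (simp add: vanishing_ideal_def eval_simps)
      moreover have "smul (inverse (\<phi> a x)) a \<in> I" using I a by (simp add: smul_in_ideal)
      ultimately have "(1 - smul (inverse (\<phi> a x)) a) + smul (inverse (\<phi> a x)) a \<in> I"
        using I unfolding is_ideal_def by blast
      then show False using \<open>I \<noteq> UNIV\<close> I by (simp add: is_ideal_UNIV_iff)
    qed
    then show "I = vanishing_ideal x" using I by blast
  qed
qed

text \<open>
  Each point has a clopen neighbourhood on which some element of the ideal has no zero. Dividing
  by it on that neighbourhood puts the indicator of the neighbourhood into the ideal, and by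
  compactness finitely many of these indicators combine to \<open>1\<close>.
\<close>

lemma ideal_without_common_zero:
  assumes I: "is_ideal I"
    and no_zero: "\<And>x. x \<in> topspace X \<Longrightarrow> \<exists>a\<in>I. \<phi> a x \<noteq> 0"
  shows "1 \<in> I"
proof -
  let ?Q = "\<lambda>S. \<exists>e\<in>I. \<forall>x\<in>topspace X. \<phi> e x = (if x \<in> S then 1 else 0)"
  have "?Q (topspace X)"
  proof (rule clopen_cover_induct[where Q = ?Q])
    show "compact_space X" using stone by (simp add: Stone_space_def)
    show "?Q {}" using I by (intro bexI[of _ 0]) (auto simp: eval_zero is_ideal_def)
    fix x assume x: "x \<in> topspace X"
    from no_zero[OF x] obtain a where a: "a \<in> I" "\<phi> a x \<noteq> 0" by blast
    have "openin X {y \<in> topspace X. \<phi> a y \<in> - {0}}"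
      using continuous_eval open_nonzero by (intro openin_continuous_map_preimage) auto
    moreover have "x \<in> {y \<in> topspace X. \<phi> a y \<in> - {0}}" using x a by simp
    ultimately obtain K where K: "openin X K" "closedin X K" "x \<in> K"
        "K \<subseteq> {y \<in> topspace X. \<phi> a y \<in> - {0}}"
      by (rule Stone_space_clopen_nhd[OF stone])
    have "continuous_map X euclidean (\<lambda>y. if y \<in> K then inverse (\<phi> a y) else 0)"
      using K by (intro continuous_map_inverse_on_clopen continuous_eval) auto
    then obtain b where b: "\<And>y. y \<in> topspace X \<Longrightarrow> \<phi> b y = (if y \<in> K then inverse (\<phi> a y) else 0)"
      by (rule eval_surj) blast
    have "?Q (S \<union> K)" if S: "openin X S" "closedin X S" and Q: "?Q S" for S
    proof -
      from Q obtain e where e: "e \<in> I" "\<And>y. y \<in> topspace X \<Longrightarrow> \<phi> e y = (if y \<in> S then 1 else 0)"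
        by blast
      \<comment> \<open>\<open>b a\<close> is the indicator of \<open>K\<close>, so this is the indicator of \<open>S \<union> K\<close>.\<close>
      have "e + ((1 - e) * b) * a \<in> I"
        using I e(1) a(1) unfolding is_ideal_def by blast
      moreover have "\<phi> (e + ((1 - e) * b) * a) y = (if y \<in> S \<union> K then 1 else 0)"
        if "y \<in> topspace X" for y
        using that e(2)[OF that] b[OF that] K(4) by (auto simp: eval_simps)
      ultimately show ?thesis by blast
    qed
    with K show "\<exists>K. openin X K \<and> closedin X K \<and> x \<in> K \<and>
        (\<forall>S. openin X S \<longrightarrow> closedin X S \<longrightarrow> ?Q S \<longrightarrow> ?Q (S \<union> K))" by blast
  qed
  then obtain e where "e \<in> I" "\<And>x. x \<in> topspace X \<Longrightarrow> \<phi> e x = 1" by auto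
  moreover from this have "e = 1" by (intro eval_eqI) (simp add: eval_one)
  ultimately show ?thesis by simp
qed

lemma Max_ideals_eq: "Max_ideals = vanishing_ideal ` topspace X"
proof (intro equalityI subsetI)
  fix M :: "'a set" assume M: "M \<in> Max_ideals"
  then have ideal: "is_ideal M" "M \<noteq> UNIV" by (auto simp: Max_ideals_def)
  then obtain x where x: "x \<in> topspace X" "M \<subseteq> vanishing_ideal x"
    using ideal_without_common_zero[of M] by (auto simp: vanishing_ideal_def is_ideal_UNIV_iff)
  have "vanishing_ideal x = M"
    using M x vanishing_ideal_maximal[OF x(1)] unfolding Max_ideals_def by blast
  with x show "M \<in> vanishing_ideal ` topspace X" by blast
qed (use vanishing_ideal_maximal in blast)

sublocale gelfand_algebra smul
proof
  show "Gelfand smul"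
    unfolding Gelfand_def Max_ideals_eq
  proof (intro ballI)
    fix M assume "M \<in> vanishing_ideal ` topspace X"
    then obtain x where x: "x \<in> topspace X" "M = vanishing_ideal x" by blast
    then have M: "is_ideal M" using vanishing_ideal_maximal by (auto simp: Max_ideals_def)
    show "bij_betw (canonical_map smul M) UNIV (range (coset_of M))"
      unfolding bij_betw_def
    proof
      show "inj (canonical_map smul M)"
        by (rule injI)
          (simp add: canonical_map_def coset_of_eq_iff[OF M], simp add: x vanishing_ideal_def eval_simps)
      have "coset_of M a = canonical_map smul M (\<phi> a x)" for a
        by (simp add: canonical_map_def coset_of_eq_iff[OF M])
          (simp add: x vanishing_ideal_def eval_simps)
      then show "range (canonical_map smul M) = range (coset_of M)"
        by (auto simp: canonical_map_def)
    qed
  qed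
qed

lemma residue_vanishing_ideal:
  assumes "x \<in> topspace X"
  shows "residue (vanishing_ideal x) a = \<phi> a x"
  unfolding residue_eq_iff[OF vanishing_ideal_maximal[OF assms]]
  using assms by (simp add: vanishing_ideal_def eval_simps)

lemma residues_diff_in_iff:
  "(\<forall>M\<in>Max_ideals. residue M a - residue M b \<in> U) \<longleftrightarrow>
    (\<forall>x\<in>topspace X. \<phi> a x - \<phi> b x \<in> U)"
  by (simp add: Max_ideals_eq residue_vanishing_ideal)

theorem semisimple_algebra: "semisimple TYPE('a)"
proof -
  have "a = 0" if a: "\<And>M. M \<in> Max_ideals \<Longrightarrow> a \<in> M" for a :: 'a
  proof (rule eval_eqI)
    fix x assume x: "x \<in> topspace X"
    then show "\<phi> a x = \<phi> 0 x"
      using a[OF vanishing_ideal_maximal[OF x]] by (simp add: vanishing_ideal_def eval_zero)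
  qed
  moreover have "0 \<in> M" if "M \<in> Max_ideals" for M :: "'a set"
    using that by (simp add: Max_ideals_def is_ideal_def)
  ultimately show ?thesis unfolding semisimple_def by blast
qed

theorem dense_span_idempotents:
  "uniformity_topology uniformity closure_of span idempotents = UNIV"
  unfolding dense_iff_uniform_approximation
proof (intro allI impI)
  fix a and U :: "'f set" assume U: "open U" "0 \<in> U"
  obtain s where "s \<in> span idempotents" "\<And>x. x \<in> topspace X \<Longrightarrow> \<phi> s x - \<phi> a x \<in> U"
    by (rule clopen_approximation[OF stone, of "\<lambda>x a. \<phi> a x" "\<phi> a" U])
      (auto simp: eval_simps eval_indicator continuous_eval U)
  then show "\<exists>s\<in>span idempotents. \<forall>M\<in>Max_ideals. residue M s - residue M a \<in> U"
    unfolding residues_diff_in_iff by blast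
qed

text \<open>
  The canonical uniformity is that of uniform convergence on \<open>X\<close>. A Cauchy filter therefore
  converges pointwise because \<open>F\<close> is complete, then uniformly, and the limit is continuous.
\<close>

theorem complete_uniformity:
  assumes "uniformity_complete (additive_uniformity :: ('f \<times> 'f) filter)"
  shows "uniformity_complete uniformity"
  unfolding uniformity_complete_def cauchy_iff_uniformly_cauchy limitin_iff_uniform_convergence
proof (intro allI impI, elim conjE)
  fix \<Phi> :: "'a filter"
  assume "\<Phi> \<noteq> bot" and "\<forall>U. open U \<longrightarrow> 0 \<in> U \<longrightarrow> (\<exists>P. eventually P \<Phi> \<and>
      (\<forall>a b. P a \<longrightarrow> P b \<longrightarrow> (\<forall>M\<in>Max_ideals. residue M b - residue M a \<in> U)))"
  then have cauchy: "\<exists>P. eventually P \<Phi> \<and>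
      (\<forall>a b. P a \<longrightarrow> P b \<longrightarrow> (\<forall>x\<in>topspace X. \<phi> b x - \<phi> a x \<in> U))"
    if "open U" "0 \<in> U" for U
    using that unfolding residues_diff_in_iff by blast
  have "\<exists>l. \<forall>U. open U \<longrightarrow> 0 \<in> U \<longrightarrow> eventually (\<lambda>a. \<phi> a x - l \<in> U) \<Phi>"
    if x: "x \<in> topspace X" for x
  proof -
    have "\<exists>P. eventually P \<Phi> \<and> (\<forall>a b. P a \<longrightarrow> P b \<longrightarrow> \<phi> b x - \<phi> a x \<in> U)"
      if "open U" "0 \<in> U" for U
      using cauchy[OF that] x by blast
    then show ?thesis
      using complete_field_cauchy_limit[OF assms \<open>\<Phi> \<noteq> bot\<close>, of "\<lambda>a. \<phi> a x"] by metis
  qed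
  then obtain g where g: "\<And>x U. x \<in> topspace X \<Longrightarrow> open U \<Longrightarrow> 0 \<in> U \<Longrightarrow>
      eventually (\<lambda>a. \<phi> a x - g x \<in> U) \<Phi>" by metis
  have unif: "eventually (\<lambda>a. \<forall>x\<in>topspace X. \<phi> a x - g x \<in> U) \<Phi>" if U: "open U" "0 \<in> U" for U
  proof -
    obtain W where W: "open W" "0 \<in> W" "\<And>x. x \<in> W \<Longrightarrow> - x \<in> W"
        "\<And>x y. x \<in> W \<Longrightarrow> y \<in> W \<Longrightarrow> x + y \<in> U"
      by (rule symmetric_nhd_add_subset[OF U]) blast
    from cauchy[OF W(1,2)] obtain P where P: "eventually P \<Phi>"
        "\<And>a b x. P a \<Longrightarrow> P b \<Longrightarrow> x \<in> topspace X \<Longrightarrow> \<phi> b x - \<phi> a x \<in> W" by blast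
    from P(1) show ?thesis
    proof eventually_elim
      case (elim a)
      show ?case
      proof
        fix x assume x: "x \<in> topspace X"
        have "eventually (\<lambda>b. P b \<and> \<phi> b x - g x \<in> W) \<Phi>"
          using P(1) g[OF x W(1,2)] by (rule eventually_conj)
        then obtain b where b: "P b" "\<phi> b x - g x \<in> W"
          using \<open>\<Phi> \<noteq> bot\<close> eventually_happens by blast
        have "(\<phi> a x - \<phi> b x) + (\<phi> b x - g x) \<in> U"
          using P(2)[OF b(1) elim x] b(2) by (rule W(4))
        then show "\<phi> a x - g x \<in> U" by simp
      qed
    qed
  qed
  have "continuous_map X euclidean g"
  proof (rule continuous_map_uniform_limit)
    fix U :: "'f set" assume "open U" "0 \<in> U"
    from unif[OF this] obtain a where "\<forall>x\<in>topspace X. \<phi> a x - g x \<in> U"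
      using \<open>\<Phi> \<noteq> bot\<close> eventually_happens by blast
    then show "\<exists>h. continuous_map X euclidean h \<and> (\<forall>x\<in>topspace X. h x - g x \<in> U)"
      using continuous_eval by blast
  qed
  then obtain l where l: "\<And>x. x \<in> topspace X \<Longrightarrow> \<phi> l x = g x" by (rule eval_surj) blast
  show "\<exists>l. \<forall>U. open U \<longrightarrow> 0 \<in> U \<longrightarrow>
      eventually (\<lambda>a. \<forall>M\<in>Max_ideals. residue M a - residue M l \<in> U) \<Phi>"
    unfolding residues_diff_in_iff
    using unif by (intro exI[of _ l]) (simp add: l)
qed

end

section \<open>The maximal spectrum as a Stone space\<close>

locale semisimple_gelfand_algebra = gelfand_algebra smul
  for smul :: "'f::topological_field \<Rightarrow> 'a::{comm_ring, comm_monoid_mult} \<Rightarrow> 'a" +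
  assumes semisimple: "semisimple TYPE('a)"
    and dense: "uniformity_topology (algebra_uniformity smul) closure_of span idempotents = UNIV"
begin

definition basic_clopen :: "'a \<Rightarrow> 'a set set" where
  "basic_clopen e = {M \<in> Max_ideals. e \<notin> M}"

text \<open>
  The topology generated by the supports of idempotents. It is a priori coarser than the one in
  which all residues are continuous, and this makes compactness purely algebraic; density of
  the span of the idempotents then shows that it is fine enough.
\<close>

definition spectrum_topology :: "'a set topology" where
  "spectrum_topology = topology (\<lambda>U. U \<subseteq> Max_ideals \<and>
     (\<forall>M\<in>U. \<exists>e\<in>idempotents. M \<in> basic_clopen e \<and> basic_clopen e \<subseteq> U))"

lemma mem_basic_clopen_iff:
  assumes "M \<in> Max_ideals" "e \<in> idempotents"
  shows "M \<in> basic_clopen e \<longleftrightarrow> residue M e = 1"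
  using residue_idempotent[OF assms] residue_eq_0_iff[OF assms(1), of e] assms(1)
  by (auto simp: basic_clopen_def)

lemma residue_idempotent_eq:
  assumes "M \<in> Max_ideals" "e \<in> idempotents"
  shows "residue M e = (if M \<in> basic_clopen e then 1 else 0)"
  using residue_idempotent[OF assms] mem_basic_clopen_iff[OF assms] by auto

lemma basic_clopen_subset: "basic_clopen e \<subseteq> Max_ideals"
  by (auto simp: basic_clopen_def)

lemma basic_clopen_one: "basic_clopen 1 = Max_ideals"
  using basic_clopen_subset by (auto simp: mem_basic_clopen_iff idempotent_one residue_one)

lemma basic_clopen_complement:
  assumes "e \<in> idempotents"
  shows "basic_clopen (1 - e) = Max_ideals - basic_clopen e"
proof -
  have "M \<in> basic_clopen (1 - e) \<longleftrightarrow> M \<in> Max_ideals - basic_clopen e" if M: "M \<in> Max_ideals" for M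
    using residue_idempotent[OF M assms]
    by (auto simp: mem_basic_clopen_iff M assms idempotent_complement residue_diff residue_one)
  then show ?thesis using basic_clopen_subset by blast
qed

lemma basic_clopen_mult:
  assumes "e \<in> idempotents" "f \<in> idempotents"
  shows "basic_clopen (e * f) = basic_clopen e \<inter> basic_clopen f"
proof -
  have "M \<in> basic_clopen (e * f) \<longleftrightarrow> M \<in> basic_clopen e \<inter> basic_clopen f"
    if M: "M \<in> Max_ideals" for M
    using residue_idempotent[OF M assms(1)] residue_idempotent[OF M assms(2)]
    by (auto simp: mem_basic_clopen_iff M assms idempotent_mult residue_mult)
  then show ?thesis using basic_clopen_subset by blast
qed

lemma basic_clopen_join:
  assumes "e \<in> idempotents" "f \<in> idempotents"
  shows "basic_clopen (e + f - e * f) = basic_clopen e \<union> basic_clopen f"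
proof -
  have "M \<in> basic_clopen (e + f - e * f) \<longleftrightarrow> M \<in> basic_clopen e \<union> basic_clopen f"
    if M: "M \<in> Max_ideals" for M
    using residue_idempotent[OF M assms(1)] residue_idempotent[OF M assms(2)]
    by (auto simp: mem_basic_clopen_iff M assms idempotent_join residue_mult residue_add residue_diff)
  then show ?thesis using basic_clopen_subset by blast
qed

lemma openin_spectrum_topology:
  "openin spectrum_topology U \<longleftrightarrow> U \<subseteq> Max_ideals \<and>
     (\<forall>M\<in>U. \<exists>e\<in>idempotents. M \<in> basic_clopen e \<and> basic_clopen e \<subseteq> U)"
proof -
  have "istopology (\<lambda>U. U \<subseteq> Max_ideals \<and>
     (\<forall>M\<in>U. \<exists>e\<in>idempotents. M \<in> basic_clopen e \<and> basic_clopen e \<subseteq> U))"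
    unfolding istopology_def
  proof (intro conjI allI impI ballI)
    fix S T M
    assume "S \<subseteq> Max_ideals \<and> (\<forall>M\<in>S. \<exists>e\<in>idempotents. M \<in> basic_clopen e \<and> basic_clopen e \<subseteq> S)"
      and "T \<subseteq> Max_ideals \<and> (\<forall>M\<in>T. \<exists>e\<in>idempotents. M \<in> basic_clopen e \<and> basic_clopen e \<subseteq> T)"
      and "M \<in> S \<inter> T"
    then obtain e f where "e \<in> idempotents" "M \<in> basic_clopen e" "basic_clopen e \<subseteq> S"
      "f \<in> idempotents" "M \<in> basic_clopen f" "basic_clopen f \<subseteq> T" by blast
    then show "\<exists>e\<in>idempotents. M \<in> basic_clopen e \<and> basic_clopen e \<subseteq> S \<inter> T"
      by (intro bexI[of _ "e * f"]) (auto simp: basic_clopen_mult idempotent_mult)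
  next
    fix K M
    assume "\<forall>S\<in>K. S \<subseteq> Max_ideals \<and>
        (\<forall>M\<in>S. \<exists>e\<in>idempotents. M \<in> basic_clopen e \<and> basic_clopen e \<subseteq> S)"
      and "M \<in> \<Union>K"
    then show "\<exists>e\<in>idempotents. M \<in> basic_clopen e \<and> basic_clopen e \<subseteq> \<Union>K"
      by (meson UnionE Union_upper order_trans)
  qed auto
  then show ?thesis by (simp add: spectrum_topology_def)
qed

lemma openin_basic_clopen: "e \<in> idempotents \<Longrightarrow> openin spectrum_topology (basic_clopen e)"
  using basic_clopen_subset by (auto simp: openin_spectrum_topology)

lemma topspace_spectrum_topology: "topspace spectrum_topology = Max_ideals"
proof -
  have "openin spectrum_topology Max_ideals"
    using openin_basic_clopen[OF idempotent_one] by (simp add: basic_clopen_one)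
  then have "Max_ideals \<subseteq> topspace spectrum_topology" by (rule openin_subset)
  moreover have "topspace spectrum_topology \<subseteq> Max_ideals"
    using openin_topspace[of spectrum_topology] by (simp only: openin_spectrum_topology)
  ultimately show ?thesis by (rule equalityI[rotated])
qed

lemma closedin_basic_clopen: "e \<in> idempotents \<Longrightarrow> closedin spectrum_topology (basic_clopen e)"
  using openin_basic_clopen[OF idempotent_complement, of e] basic_clopen_subset[of e]
  by (simp add: closedin_def topspace_spectrum_topology basic_clopen_complement)

lemma basic_clopen_nhd:
  assumes "openin spectrum_topology U" "M \<in> U"
  obtains e where "e \<in> idempotents" "M \<in> basic_clopen e" "basic_clopen e \<subseteq> U"
  using assms unfolding openin_spectrum_topology by blast

text \<open>
  The idempotents whose support is covered by finitely many members of the cover generate an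
  ideal. It lies in no maximal ideal \<open>M\<close>, since some idempotent outside \<open>M\<close> has its support in a
  member of the cover. Hence it contains \<open>1\<close>, whose support is the whole spectrum.
\<close>

lemma compact_spectrum: "compact_space spectrum_topology"
  unfolding compact_space_alt topspace_spectrum_topology
proof (intro allI impI, elim conjE)
  fix \<U> assume open_cover: "\<forall>U\<in>\<U>. openin spectrum_topology U" and cover: "Max_ideals \<subseteq> \<Union>\<U>"
  define covered where "covered f \<longleftrightarrow>
    f \<in> idempotents \<and> (\<exists>\<F>. finite \<F> \<and> \<F> \<subseteq> \<U> \<and> basic_clopen f \<subseteq> \<Union>\<F>)" for f
  \<comment> \<open>The covered idempotents are closed under joins, so the multiples of single ones already
      form the ideal that they generate.\<close>
  define I where "I = {a. \<exists>f. covered f \<and> a * f = a}"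
  have "is_ideal I"
    unfolding is_ideal_def
  proof (intro conjI ballI allI)
    have "0 \<notin> M \<Longrightarrow> M \<notin> Max_ideals" for M :: "'a set"
      by (auto simp: Max_ideals_def is_ideal_def)
    then have "covered 0"
      unfolding covered_def by (auto simp: idempotents_def basic_clopen_def intro!: exI[of _ "{}"])
    then show "0 \<in> I" unfolding I_def by auto
    fix a assume "a \<in> I"
    then obtain f where f: "covered f" "a * f = a" by (auto simp: I_def)
    show "b * a \<in> I" for b
      unfolding I_def using f by (auto simp: mult.assoc)
    fix b assume "b \<in> I"
    then obtain h where h: "covered h" "b * h = b" by (auto simp: I_def)
    from f(1) h(1) obtain \<F> \<H> where FH: "finite \<F>" "\<F> \<subseteq> \<U>" "basic_clopen f \<subseteq> \<Union>\<F>"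
      "finite \<H>" "\<H> \<subseteq> \<U>" "basic_clopen h \<subseteq> \<Union>\<H>" and idem: "f \<in> idempotents" "h \<in> idempotents"
      unfolding covered_def by blast
    have "covered (f + h - f * h)"
      unfolding covered_def basic_clopen_join[OF idem]
      using FH idem by (intro conjI exI[of _ "\<F> \<union> \<H>"]) (auto simp: idempotent_join)
    moreover have "(a + b) * (f + h - f * h) = a + b"
    proof -
      have "a * (f + h - f * h) = a * f + a * h - (a * f) * h"
        "b * (f + h - f * h) = b * f + b * h - (b * h) * f"
        by (simp_all add: distrib_left right_diff_distrib mult.assoc mult.commute[of h f])
      then show ?thesis by (simp add: f h distrib_right)
    qed
    ultimately show "a + b \<in> I" unfolding I_def by blast
  qed
  have "1 \<in> I"
  proof (rule ccontr)
    assume "1 \<notin> I"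
    then obtain M where M: "M \<in> Max_ideals" "I \<subseteq> M"
      using proper_ideal_in_maximal[OF \<open>is_ideal I\<close>] by blast
    then obtain U where U: "U \<in> \<U>" "M \<in> U" using cover by blast
    then obtain e where e: "e \<in> idempotents" "M \<in> basic_clopen e" "basic_clopen e \<subseteq> U"
      using open_cover basic_clopen_nhd by metis
    then have "covered e" unfolding covered_def using U by (auto intro!: exI[of _ "{U}"])
    then have "e \<in> I" using e(1) unfolding I_def idempotents_def by blast
    then show False using M e(2) by (auto simp: basic_clopen_def)
  qed
  then have "covered 1" by (auto simp: I_def)
  then show "\<exists>\<F>. finite \<F> \<and> \<F> \<subseteq> \<U> \<and> Max_ideals \<subseteq> \<Union>\<F>"
    by (simp add: covered_def basic_clopen_one)
qed

text \<open>
  Residues of idempotents determine residues on their span and, by density, everywhere, as the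
  topology of \<open>F\<close> is Hausdorff; and a maximal ideal is the kernel of its residue map.
\<close>

lemma idempotents_separate:
  assumes M: "M \<in> Max_ideals" "N \<in> Max_ideals"
    and eq: "\<And>e. e \<in> idempotents \<Longrightarrow> residue M e = residue N e"
  shows "M = N"
proof -
  have span_eq: "residue M s = residue N s" if "s \<in> span idempotents" for s
    using that
  proof (induction rule: span_induct_alt)
    case base
    then show ?case using residue_diff[OF M(1), of 0 0] residue_diff[OF M(2), of 0 0] by simp
  next
    case (step c e s)
    then show ?case by (simp add: residue_add residue_smul M eq)
  qed
  have "residue M a = residue N a" for a
  proof (rule eq_if_diff_in_all_nhds)
    fix U :: "'f set" assume U: "open U" "0 \<in> U"
    obtain W where W: "open W" "0 \<in> W" "\<And>x. x \<in> W \<Longrightarrow> - x \<in> W"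
        "\<And>x y. x \<in> W \<Longrightarrow> y \<in> W \<Longrightarrow> x + y \<in> U"
      by (rule symmetric_nhd_add_subset[OF U]) blast
    obtain s where s: "s \<in> span idempotents"
        "\<And>M. M \<in> Max_ideals \<Longrightarrow> residue M s - residue M a \<in> W"
      using dense W(1,2) unfolding dense_iff_uniform_approximation by blast
    have "- (residue M s - residue M a) + (residue N s - residue N a) \<in> U"
      using s(2) M W(3,4) by blast
    then show "residue M a - residue N a \<in> U" by (simp add: span_eq[OF s(1)])
  qed
  then show ?thesis
    using residue_eq_0_iff[OF M(1)] residue_eq_0_iff[OF M(2)] by auto
qed

lemma Stone_space_spectrum: "Stone_space spectrum_topology"
  unfolding Stone_space_def
proof (intro conjI compact_spectrum)
  show "Hausdorff_space spectrum_topology"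
    unfolding Hausdorff_space_def topspace_spectrum_topology
  proof (intro allI impI)
    fix M N :: "'a set" assume MN: "M \<in> Max_ideals \<and> N \<in> Max_ideals \<and> M \<noteq> N"
    then obtain e where e: "e \<in> idempotents" "residue M e \<noteq> residue N e"
      using idempotents_separate by blast
    have opens: "openin spectrum_topology (basic_clopen e)"
        "openin spectrum_topology (basic_clopen (1 - e))"
      using e(1) by (simp_all add: openin_basic_clopen idempotent_complement)
    have disj: "disjnt (basic_clopen e) (basic_clopen (1 - e))"
      using e(1) by (auto simp: basic_clopen_complement disjnt_iff)
    have "M \<in> basic_clopen e \<and> N \<in> basic_clopen (1 - e) \<or>
        M \<in> basic_clopen (1 - e) \<and> N \<in> basic_clopen e"
      using e MN by (auto simp: basic_clopen_complement residue_idempotent_eq split: if_splits)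
    then show "\<exists>U V. openin spectrum_topology U \<and> openin spectrum_topology V \<and>
        M \<in> U \<and> N \<in> V \<and> disjnt U V"
      using opens disj disjnt_sym by metis
  qed
  show "neighbourhood_base_of (\<lambda>U. openin spectrum_topology U \<and> closedin spectrum_topology U)
          spectrum_topology"
    unfolding neighbourhood_base_of
  proof (intro allI impI, elim conjE)
    fix W M assume "openin spectrum_topology W" "M \<in> W"
    then obtain e where "e \<in> idempotents" "M \<in> basic_clopen e" "basic_clopen e \<subseteq> W"
      by (rule basic_clopen_nhd)
    then show "\<exists>U V. openin spectrum_topology U \<and>
        (openin spectrum_topology V \<and> closedin spectrum_topology V) \<and> M \<in> U \<and> U \<subseteq> V \<and> V \<subseteq> W"
      using openin_basic_clopen closedin_basic_clopen by blast
  qed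
qed

text \<open>
  A clopen set is a finite union of supports of idempotents by compactness, and the join of the
  idempotents has this union as its support.
\<close>

lemma clopen_is_basic:
  assumes S: "openin spectrum_topology S" "closedin spectrum_topology S"
  shows "\<exists>e\<in>idempotents. basic_clopen e = S"
proof -
  let ?Q = "\<lambda>T. \<exists>e\<in>idempotents. basic_clopen e = T \<inter> S"
  have "?Q (topspace spectrum_topology)"
  proof (rule clopen_cover_induct[OF compact_spectrum, where Q = ?Q])
    have "(0::'a) \<in> idempotents" "basic_clopen 0 = {}"
      by (auto simp: idempotents_def basic_clopen_def Max_ideals_def is_ideal_def)
    then show "?Q {}" by auto
    fix M assume M: "M \<in> topspace spectrum_topology"
    show "\<exists>K. openin spectrum_topology K \<and> closedin spectrum_topology K \<and> M \<in> K \<and>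
        (\<forall>T. openin spectrum_topology T \<longrightarrow> closedin spectrum_topology T \<longrightarrow> ?Q T \<longrightarrow> ?Q (T \<union> K))"
    proof (cases "M \<in> S")
      case True
      with S(1) obtain f where f: "f \<in> idempotents" "M \<in> basic_clopen f" "basic_clopen f \<subseteq> S"
        by (rule basic_clopen_nhd)
      have "?Q (T \<union> basic_clopen f)" if "?Q T" for T
      proof -
        from that obtain e where "e \<in> idempotents" "basic_clopen e = T \<inter> S" by blast
        then show ?thesis
          using f by (intro bexI[of _ "e + f - e * f"]) (auto simp: basic_clopen_join idempotent_join)
      qed
      then show ?thesis
        using f(2) openin_basic_clopen[OF f(1)] closedin_basic_clopen[OF f(1)]
        by (intro exI[of _ "basic_clopen f"]) simp
    next
      case False
      have "(T \<union> (topspace spectrum_topology - S)) \<inter> S = T \<inter> S" for T by blast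
      then show ?thesis using S M False
        by (intro exI[of _ "topspace spectrum_topology - S"]) auto
    qed
  qed
  moreover have "topspace spectrum_topology \<inter> S = S"
    using openin_subset[OF S(1)] by (rule inf_absorb2)
  ultimately show ?thesis by simp
qed

text \<open>
  On the span of the idempotents residues are combinations of indicators of clopen sets, and the
  residue of an arbitrary element is a uniform limit of these.
\<close>

lemma continuous_residue: "continuous_map spectrum_topology euclidean (\<lambda>M. residue M a)"
proof (rule continuous_map_uniform_limit)
  have span_continuous: "continuous_map spectrum_topology euclidean (\<lambda>M. residue M s)"
    if "s \<in> span idempotents" for s
    using that
  proof (induction rule: span_induct_alt)
    case base
    have "residue M 0 = 0" if "M \<in> Max_ideals" for M
      using residue_diff[OF that, of 0 0] by simp
    then show ?case
      by (intro continuous_map_eq[OF continuous_map_const[THEN iffD2], of _ 0])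
        (auto simp: topspace_spectrum_topology)
  next
    case (step c e s)
    have "continuous_map spectrum_topology euclidean
        (\<lambda>M. if M \<in> basic_clopen e then inverse 1 else 0 :: 'f)"
      using step(1) openin_basic_clopen closedin_basic_clopen
      by (intro continuous_map_inverse_on_clopen) auto
    then have "continuous_map spectrum_topology euclidean
        (\<lambda>M. c * (if M \<in> basic_clopen e then inverse 1 else 0) + residue M s)"
      using step(2) unfolding continuous_map_atin limitin_canonical_iff
      by (intro ballI tendsto_add tendsto_mult tendsto_const) blast+
    then show ?case
      by (rule continuous_map_eq)
        (simp add: topspace_spectrum_topology residue_add residue_smul residue_idempotent_eq step(1))
  qed
  fix U :: "'f set" assume "open U" "0 \<in> U"
  then obtain s where "s \<in> span idempotents" "\<And>M. M \<in> Max_ideals \<Longrightarrow> residue M s - residue M a \<in> U"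
    using dense unfolding dense_iff_uniform_approximation by blast
  then show "\<exists>h. continuous_map spectrum_topology euclidean h \<and>
      (\<forall>M\<in>topspace spectrum_topology. h M - residue M a \<in> U)"
    using span_continuous by (intro exI[of _ "\<lambda>M. residue M s"]) (auto simp: topspace_spectrum_topology)
qed

text \<open>
  The elements whose residues are uniformly close to \<open>g\<close> form a filter: it is proper by
  approximation of \<open>g\<close> on clopen sets, and it is Cauchy. Completeness provides an element whose
  residues are exactly \<open>g\<close>.
\<close>

lemma residue_surj:
  assumes complete: "uniformity_complete uniformity"
    and g: "continuous_map spectrum_topology euclidean g"
  obtains a where "\<And>M. M \<in> Max_ideals \<Longrightarrow> residue M a = g M"
proof -
  let ?near = "\<lambda>U. {a. \<forall>M\<in>Max_ideals. residue M a - g M \<in> U}"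
  let ?B = "{U::'f set. open U \<and> 0 \<in> U}"
  define \<Phi> where "\<Phi> = (INF U\<in>?B. principal (?near U))"
  have ev: "eventually P \<Phi> \<longleftrightarrow> (\<exists>U\<in>?B. \<forall>a\<in>?near U. P a)" for P
  proof -
    have "eventually P \<Phi> \<longleftrightarrow> (\<exists>U\<in>?B. eventually P (principal (?near U)))"
      unfolding \<Phi>_def
    proof (rule eventually_INF_base)
      show "?B \<noteq> {}" by (auto intro!: exI[of _ UNIV])
      fix U V assume "U \<in> ?B" "V \<in> ?B"
      then show "\<exists>W\<in>?B. principal (?near W) \<le> inf (principal (?near U)) (principal (?near V))"
        by (intro bexI[of _ "U \<inter> V"]) auto
    qed
    then show ?thesis by (simp add: eventually_principal)
  qed
  have "?near U \<noteq> {}" if U: "open U" "0 \<in> U" for U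
  proof -
    have indicator: "\<exists>e\<in>idempotents. \<forall>M\<in>topspace spectrum_topology.
        residue M e = (if M \<in> S then 1 else 0)"
      if "openin spectrum_topology S" "closedin spectrum_topology S" for S
      using clopen_is_basic[OF that] residue_idempotent_eq by (metis topspace_spectrum_topology)
    obtain a where "\<And>M. M \<in> topspace spectrum_topology \<Longrightarrow> residue M a - g M \<in> U"
      by (rule clopen_approximation[OF Stone_space_spectrum, of residue g U])
        (auto simp: topspace_spectrum_topology residue_add residue_smul g U
          indicator[unfolded topspace_spectrum_topology])
    then show ?thesis by (auto simp: topspace_spectrum_topology)
  qed
  then have "\<Phi> \<noteq> bot"
    unfolding trivial_limit_def ev by blast
  moreover have "\<Phi> \<times>\<^sub>F \<Phi> \<le> uniformity"
    unfolding cauchy_iff_uniformly_cauchy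
  proof (intro allI impI)
    fix U :: "'f set" assume U: "open U" "0 \<in> U"
    obtain W where W: "open W" "0 \<in> W" "\<And>x. x \<in> W \<Longrightarrow> - x \<in> W"
        "\<And>x y. x \<in> W \<Longrightarrow> y \<in> W \<Longrightarrow> x + y \<in> U"
      by (rule symmetric_nhd_add_subset[OF U]) blast
    have "eventually (\<lambda>a. a \<in> ?near W) \<Phi>" unfolding ev using W(1,2) by blast
    moreover have "residue M b - residue M a \<in> U"
      if "a \<in> ?near W" "b \<in> ?near W" "M \<in> Max_ideals" for a b M
    proof -
      have "(residue M b - g M) + - (residue M a - g M) \<in> U" using that W(3,4) by blast
      then show ?thesis by simp
    qed
    ultimately show "\<exists>P. eventually P \<Phi> \<and>
        (\<forall>a b. P a \<longrightarrow> P b \<longrightarrow> (\<forall>M\<in>Max_ideals. residue M b - residue M a \<in> U))"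
      by blast
  qed
  ultimately obtain a where a: "\<And>U. open U \<Longrightarrow> 0 \<in> U \<Longrightarrow>
      eventually (\<lambda>b. \<forall>M\<in>Max_ideals. residue M b - residue M a \<in> U) \<Phi>"
    using complete unfolding uniformity_complete_def limitin_iff_uniform_convergence by blast
  show thesis
  proof (rule that, rule eq_if_diff_in_all_nhds)
    fix M :: "'a set" and U :: "'f set" assume M: "M \<in> Max_ideals" and U: "open U" "0 \<in> U"
    obtain W where W: "open W" "0 \<in> W" "\<And>x. x \<in> W \<Longrightarrow> - x \<in> W"
        "\<And>x y. x \<in> W \<Longrightarrow> y \<in> W \<Longrightarrow> x + y \<in> U"
      by (rule symmetric_nhd_add_subset[OF U]) blast
    have "eventually (\<lambda>b. b \<in> ?near W) \<Phi>" unfolding ev using W(1,2) by blast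
    from eventually_conj[OF this a[OF W(1,2)]] obtain b
      where "b \<in> ?near W" "\<forall>M\<in>Max_ideals. residue M b - residue M a \<in> W"
      using \<open>\<Phi> \<noteq> bot\<close> eventually_happens by blast
    then have "- (residue M b - residue M a) + (residue M b - g M) \<in> U"
      using M W(3,4) by blast
    then show "residue M a - g M \<in> U" by simp
  qed
qed

theorem isomorphic_to_continuous_functions_on_spectrum:
  assumes "uniformity_complete uniformity"
  shows "isomorphic_to_continuous_functions smul spectrum_topology"
  unfolding isomorphic_to_continuous_functions_def topspace_spectrum_topology
proof (intro exI conjI allI)
  let ?G = "\<lambda>a. \<lambda>M\<in>Max_ideals. residue M a"
  show "bij_betw ?G UNIV (continuous_functions spectrum_topology)"
    unfolding bij_betw_def
  proof
    show "inj ?G"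
    proof (rule injI)
      fix a b assume eq: "?G a = ?G b"
      have "a - b \<in> M" if M: "M \<in> Max_ideals" for M
        using fun_cong[OF eq, of M] M residue_eq_0_iff[OF M, of "a - b"]
        by (simp add: residue_diff)
      then have "a - b = 0" using semisimple unfolding semisimple_def by blast
      then show "a = b" by simp
    qed
    show "range ?G = continuous_functions spectrum_topology"
    proof (intro equalityI subsetI)
      fix g assume "g \<in> range ?G"
      then obtain a where "g = ?G a" by blast
      moreover have "continuous_map spectrum_topology euclidean (?G a)"
        by (rule continuous_map_eq[OF continuous_residue]) (simp add: topspace_spectrum_topology)
      ultimately show "g \<in> continuous_functions spectrum_topology"
        by (simp add: continuous_functions_def topspace_spectrum_topology)
    next
      fix g :: "'a set \<Rightarrow> 'f" assume g: "g \<in> continuous_functions spectrum_topology"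
      then obtain a where a: "\<And>M. M \<in> Max_ideals \<Longrightarrow> residue M a = g M"
        using residue_surj[OF assms, of g] by (auto simp: continuous_functions_def)
      have "g = ?G a"
        using g by (intro extensionalityI[of _ Max_ideals])
          (auto simp: continuous_functions_def topspace_spectrum_topology a)
      then show "g \<in> range ?G" by blast
    qed
  qed
  show "?G (a + b) = (\<lambda>x\<in>Max_ideals. ?G a x + ?G b x)"
    and "?G (a * b) = (\<lambda>x\<in>Max_ideals. ?G a x * ?G b x)" for a b
    by (auto simp: restrict_def residue_add residue_mult)
  show "?G 1 = (\<lambda>x\<in>Max_ideals. 1)"
    and "?G (smul c a) = (\<lambda>x\<in>Max_ideals. c * ?G a x)" for c a
    by (auto simp: restrict_def residue_one residue_smul)
qed

end

section \<open>The characterization\<close>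

theorem continuous_functions_imp_gelfand_complete_dense:
  fixes smul :: "'f::topological_field \<Rightarrow> 'a::{comm_ring, comm_monoid_mult} \<Rightarrow> 'a" and Y :: "'x topology"
  assumes "uniformity_complete (additive_uniformity :: ('f \<times> 'f) filter)" "unital_algebra smul"
    and Y: "Stone_space Y" "isomorphic_to_continuous_functions smul Y"
  shows "Gelfand smul \<and> semisimple TYPE('a) \<and>
    uniformity_complete (algebra_uniformity smul) \<and>
    uniformity_topology (algebra_uniformity smul) closure_of
      (module.span smul (idempotents :: 'a set)) = UNIV"
proof -
  interpret algebra_over_topological_field smul
    using assms(2) by (simp add: algebra_over_topological_field_def)
  obtain \<phi> where "continuous_function_algebra smul Y \<phi>"
    using Y unfolding isomorphic_to_continuous_functions_def
    by (auto simp: continuous_function_algebra_def continuous_function_algebra_axioms_def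
        algebra_over_topological_field_axioms)
  then interpret continuous_function_algebra smul Y \<phi> .
  show ?thesis using gelfand semisimple_algebra complete_uniformity[OF assms(1)] dense_span_idempotents by blast
qed

theorem gelfand_complete_dense_imp_continuous_functions:
  fixes smul :: "'f::topological_field \<Rightarrow> 'a::{comm_ring, comm_monoid_mult} \<Rightarrow> 'a"
  assumes "unital_algebra smul" "Gelfand smul" "semisimple TYPE('a)"
    "uniformity_complete (algebra_uniformity smul)"
    "uniformity_topology (algebra_uniformity smul) closure_of
      (module.span smul (idempotents :: 'a set)) = UNIV"
  shows "\<exists>X :: 'a set topology. Stone_space X \<and> isomorphic_to_continuous_functions smul X"
proof -
  interpret algebra_over_topological_field smul
    using assms(1) by (simp add: algebra_over_topological_field_def)
  interpret semisimple_gelfand_algebra smul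
    using assms by unfold_locales
  show ?thesis
    using Stone_space_spectrum isomorphic_to_continuous_functions_on_spectrum[OF assms(4)] by blast
qed

theorem theorem29:
  fixes smul :: "'f::topological_field \<Rightarrow> 'a::{comm_ring, comm_monoid_mult} \<Rightarrow> 'a"
  assumes "\<not> connected (UNIV :: 'f set)"
    and "uniformity_complete (additive_uniformity :: ('f \<times> 'f) filter)"
    and "unital_algebra smul"
  shows "((\<exists>X :: 'a set topology.
             Stone_space X \<and> isomorphic_to_continuous_functions smul X) \<longleftrightarrow>
          Gelfand smul \<and>
          semisimple TYPE('a) \<and>
          uniformity_complete (algebra_uniformity smul) \<and>
          uniformity_topology (algebra_uniformity smul) closure_of
            (module.span smul (idempotents :: 'a set)) = UNIV) \<and>
         (\<forall>Y :: 'x topology.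
            Stone_space Y \<and> isomorphic_to_continuous_functions smul Y \<longrightarrow>
            (\<exists>X :: 'a set topology.
               Stone_space X \<and> isomorphic_to_continuous_functions smul X))"
proof (intro conjI iffI allI impI)
  assume "\<exists>X :: 'a set topology. Stone_space X \<and> isomorphic_to_continuous_functions smul X"
  then obtain X :: "'a set topology"
    where "Stone_space X" "isomorphic_to_continuous_functions smul X" by blast
  note * = continuous_functions_imp_gelfand_complete_dense[OF assms(2,3) this]
  show "Gelfand smul" "semisimple TYPE('a)" "uniformity_complete (algebra_uniformity smul)"
    "uniformity_topology (algebra_uniformity smul) closure_of
      (module.span smul (idempotents :: 'a set)) = UNIV"
    using * by blast+
next
  assume "Gelfand smul \<and> semisimple TYPE('a) \<and> uniformity_complete (algebra_uniformity smul) \<and>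
    uniformity_topology (algebra_uniformity smul) closure_of
      (module.span smul (idempotents :: 'a set)) = UNIV"
  then show "\<exists>X :: 'a set topology. Stone_space X \<and> isomorphic_to_continuous_functions smul X"
    using gelfand_complete_dense_imp_continuous_functions[OF assms(3)] by blast
next
  fix Y :: "'x topology"
  assume "Stone_space Y \<and> isomorphic_to_continuous_functions smul Y"
  then show "\<exists>X :: 'a set topology. Stone_space X \<and> isomorphic_to_continuous_functions smul X"
    using continuous_functions_imp_gelfand_complete_dense[OF assms(2,3), of Y]
      gelfand_complete_dense_imp_continuous_functions[OF assms(3)] by blast
qed

end
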